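(* Let $\mathbb{F}_\theta^+$ be a $k$-graph on a single vertex, let $p,q\ge1$ with $p+q\le k$, and let $a_1,\dots,a_p,b_{p+1},\dots,b_{p+q}$ be positive integers. Put $$\pi=(a_1,\dots,a_p,-b_{p+1},\dots,-b_{p+q},0,\dots,0)\in\mathbb{Z}^k .$$ Let $$E=\Big\{\prod_{i=1}^p e^i_{u_i}: u_i\in\{1,\dots,m_i\}^{a_i}\Big\},\qquad F=\Big\{\prod_{j=p+1}^{p+q}e^j_{v_j}: v_j\in\{1,\dots,m_j\}^{b_j}\Big\}.$$ The following are equivalent: (i) $\mathbb{F}_\theta^+$ is $\pi$-periodic, i.e. every infinite tail of $\mathbb{F}_\theta^+$ is eventually $\pi$-periodic. (ii) Every infinite tail of $\mathbb{F}_\theta^+$ is $\pi$-periodic. (iii) There is a bijection $\gamma:E\to F$ such that $$ef=\gamma(e)\gamma^{-1}(f)\quad\text{for all }e\in E,\ f\in F,$$ and $$e\tau=\gamma(e)\tau\quad\text{for every infinite tail }\tau\text{ and every }e\in E.$$ Moreover, if $p+q=k$, then the condition $e\tau=\gamma(e)\tau$ in (iii) is automatic, i.e. it holds for every bijection $\gamma:E\to F$ satisfying $ef=\gamma(e)\gamma^{-1}(f)$ for all $e\in E$, $f\in F$.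
   Context: $k$-graph on a single vertex: a unital semigroup $\mathbb{F}_\theta^+$ generated by elements $e^i_{s}$ ($1\le i\le k$, $1\le s\le m_i$), with no relations among the $e^i_s$ for fixed $i$, and relations $e^i_s e^j_t=e^j_{t'}e^i_{s'}$ for $i<j$, where $(s',t')=\theta_{ij}(s,t)$ and $\theta_{ij}$ is a permutation of $\{1,\dots,m_i\}\times\{1,\dots,m_j\}$; it is assumed that, with $\deg:\mathbb{F}_\theta^+\to\mathbb{N}_0^k$ the homomorphism with $\deg(e^i_s)=\varepsilon_i$ (standard generator), every $w$ with $\deg(w)=m+n$ factors uniquely as $w=uv$ with $\deg u=m$, $\deg v=n$. For a word $u=s_1\cdots s_r$ in $\{1,\dots,m_i\}$, $e^i_u=e^i_{s_1}\cdots e^i_{s_r}$. Tails: an infinite tail $\tau$ is an infinite word in the generators containing infinitely many letters from each family $\{e^i_1,\dots,e^i_{m_i}\}$; for each $n\in\mathbb{N}_0^k$ it has a unique initial segment $w_n$ of degree $n$ (after refactoring by the commutation relations), and two tails are equal when they have the same initial segments of every degree. For $w\in\mathbb{F}_\theta^+$, $w\tau$ is the tail obtained by prefixing $w$. For $n\in\mathbb{N}_0^k$ define $\Sigma(\tau,-n)=(t^1,\dots,t^k)$ where $w_{n+\varepsilon_i}=w_n e^i_{t^i}$. For $p\in\mathbb{Z}^k$, $\tau$ is $p$-periodic if $\Sigma(\tau,n)=\Sigma(\tau,n+p)$ for all $n\in\mathbb{Z}^k$ with $n\le0$ and $n+p\le 0$ (coordinatewise). $\tau$ is eventually $p$-periodic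 if there is $T\in\mathbb{Z}^k$ with $T\le0$, $T+p\le0$ such that $\Sigma(\tau,n)=\Sigma(\tau,n+p)$ for all $n\le T$. *)

theory Defs
  imports
    "HOL-Algebra.Group"
    "HOL-Library.FuncSet"
    "HOL-Library.Function_Algebras"
    "HOL-Library.Omega_Words_Fun"
begin

text \<open>
  The parameters are the rank \<open>k\<close>, the numbers \<open>m i\<close> of generators of colour
  \<open>i \<in> {1..k}\<close>, and the permutations \<open>\<theta> i j\<close> of \<open>{1..m i} \<times> {1..m j}\<close>, \<open>i < j\<close>.
  The generator \<open>e\<^sup>i\<^sub>s\<close> is the letter \<open>(i, s)\<close>.
\<close>

type_synonym letter = "nat \<times> nat"
type_synonym perms = "nat \<Rightarrow> nat \<Rightarrow> nat \<times> nat \<Rightarrow> nat \<times> nat"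

text \<open>
  The groups \<open>\<nat>\<^sub>0\<^sup>k\<close> and \<open>\<int>\<^sup>k\<close> are represented by functions vanishing outside \<open>{1..k}\<close>,
  with pointwise order and addition.
\<close>

definition vecs :: "nat \<Rightarrow> (nat \<Rightarrow> 'a::zero) set" where
  "vecs k = {n. \<forall>i. i \<notin> {1..k} \<longrightarrow> n i = 0}"

definition unit_vec :: "nat \<Rightarrow> nat \<Rightarrow> nat" where
  "unit_vec i = (\<lambda>j. if j = i then 1 else 0)"


section \<open>The semigroup of a \<open>k\<close>-graph on a single vertex\<close>

definition letters :: "nat \<Rightarrow> (nat \<Rightarrow> nat) \<Rightarrow> letter set" where
  "letters k m = {(i, s). i \<in> {1..k} \<and> s \<in> {1..m i}}"

inductive commute_step :: "nat \<Rightarrow> (nat \<Rightarrow> nat) \<Rightarrow> perms \<Rightarrow> letter list \<Rightarrow> letter list \<Rightarrow> bool"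
  for k m \<theta> where
  "\<lbrakk>1 \<le> i; i < j; j \<le> k; s \<in> {1..m i}; t \<in> {1..m j}; \<theta> i j (s, t) = (s', t')\<rbrakk>
    \<Longrightarrow> commute_step k m \<theta> (u @ [(i, s), (j, t)] @ v) (u @ [(j, t'), (i, s')] @ v)"

definition word_rel :: "nat \<Rightarrow> (nat \<Rightarrow> nat) \<Rightarrow> perms \<Rightarrow> (letter list \<times> letter list) set" where
  "word_rel k m \<theta> = {(u, v). u \<in> lists (letters k m) \<and> v \<in> lists (letters k m) \<and>
     equivclp (commute_step k m \<theta>) u v}"

definition word_class :: "nat \<Rightarrow> (nat \<Rightarrow> nat) \<Rightarrow> perms \<Rightarrow> letter list \<Rightarrow> letter list set" where
  "word_class k m \<theta> u = word_rel k m \<theta> `` {u}"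

definition semigrp :: "nat \<Rightarrow> (nat \<Rightarrow> nat) \<Rightarrow> perms \<Rightarrow> letter list set monoid" where
  "semigrp k m \<theta> = \<lparr>
     carrier = lists (letters k m) // word_rel k m \<theta>,
     monoid.mult = (\<lambda>A B. \<Union>a\<in>A. \<Union>b\<in>B. word_class k m \<theta> (a @ b)),
     one = word_class k m \<theta> []\<rparr>"

definition gen :: "nat \<Rightarrow> (nat \<Rightarrow> nat) \<Rightarrow> perms \<Rightarrow> nat \<Rightarrow> nat \<Rightarrow> letter list set" where
  "gen k m \<theta> i s = word_class k m \<theta> [(i, s)]"

text \<open>The commutation relations preserve the number of letters of each colour.\<close>

definition deg :: "letter list set \<Rightarrow> nat \<Rightarrow> nat" where
  "deg w = the_elem ((\<lambda>u i. count_list (map fst u) i) ` w)"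

text \<open>
  The sets \<open>{1..m i}\<close> are nonempty, as usual for \<open>k\<close>-graphs; otherwise there would be
  no infinite tails.
\<close>

locale single_vertex_kgraph =
  fixes k :: nat and m :: "nat \<Rightarrow> nat" and \<theta> :: perms
  assumes gens_nonempty: "\<And>i. i \<in> {1..k} \<Longrightarrow> m i \<ge> 1"
    and theta_perm: "\<And>i j. \<lbrakk>1 \<le> i; i < j; j \<le> k\<rbrakk> \<Longrightarrow>
      bij_betw (\<theta> i j) ({1..m i} \<times> {1..m j}) ({1..m i} \<times> {1..m j})"
    and unique_factorization:
      "\<And>w d d'. \<lbrakk>w \<in> carrier (semigrp k m \<theta>); d \<in> vecs k; d' \<in> vecs k; deg w = d + d'\<rbrakk> \<Longrightarrow>
        \<exists>!(u, v). u \<in> carrier (semigrp k m \<theta>) \<and> v \<in> carrier (semigrp k m \<theta>) \<and>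
          w = u \<otimes>\<^bsub>semigrp k m \<theta>\<^esub> v \<and> deg u = d \<and> deg v = d'"


section \<open>Products of words in single colours\<close>

definition list_prod :: "('a, 'b) monoid_scheme \<Rightarrow> 'a list \<Rightarrow> 'a" where
  "list_prod G xs = foldr (\<otimes>\<^bsub>G\<^esub>) xs \<one>\<^bsub>G\<^esub>"

definition gen_word :: "nat \<Rightarrow> (nat \<Rightarrow> nat) \<Rightarrow> perms \<Rightarrow> nat \<Rightarrow> nat list \<Rightarrow> letter list set" where
  "gen_word k m \<theta> i u = list_prod (semigrp k m \<theta>) (map (gen k m \<theta> i) u)"

text \<open>
  The products run over the colours \<open>l, \<dots>, h\<close> in increasing order; the word
  \<open>u i\<close> in colour \<open>i\<close> has length \<open>c i\<close>.
\<close>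

definition block_products ::
  "nat \<Rightarrow> (nat \<Rightarrow> nat) \<Rightarrow> perms \<Rightarrow> nat \<Rightarrow> nat \<Rightarrow> (nat \<Rightarrow> nat) \<Rightarrow> letter list set set" where
  "block_products k m \<theta> l h c =
    {list_prod (semigrp k m \<theta>) (map (\<lambda>i. gen_word k m \<theta> i (u i)) [l..<Suc h]) | u.
      \<forall>i\<in>{l..h}. u i \<in> lists {1..m i} \<and> length (u i) = c i}"


section \<open>Infinite tails\<close>

definition tail_words :: "nat \<Rightarrow> (nat \<Rightarrow> nat) \<Rightarrow> letter word set" where
  "tail_words k m = {x. (\<forall>r. x r \<in> letters k m) \<and> (\<forall>i\<in>{1..k}. infinite {r. fst (x r) = i})}"

text \<open>
  The initial segment of degree \<open>n\<close> is the left factor of degree \<open>n\<close> of some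
  (equivalently, every sufficiently long) finite prefix.
\<close>

definition word_init ::
  "nat \<Rightarrow> (nat \<Rightarrow> nat) \<Rightarrow> perms \<Rightarrow> letter word \<Rightarrow> (nat \<Rightarrow> nat) \<Rightarrow> letter list set" where
  "word_init k m \<theta> x n = (THE w. w \<in> carrier (semigrp k m \<theta>) \<and> deg w = n \<and>
     (\<exists>N. \<exists>v\<in>carrier (semigrp k m \<theta>).
        word_class k m \<theta> (prefix N x) = w \<otimes>\<^bsub>semigrp k m \<theta>\<^esub> v))"

definition tail_rel :: "nat \<Rightarrow> (nat \<Rightarrow> nat) \<Rightarrow> perms \<Rightarrow> (letter word \<times> letter word) set" where
  "tail_rel k m \<theta> = {(x, y). x \<in> tail_words k m \<and> y \<in> tail_words k m \<and>
     (\<forall>n\<in>vecs k. word_init k m \<theta> x n = word_init k m \<theta> y n)}"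

definition tails :: "nat \<Rightarrow> (nat \<Rightarrow> nat) \<Rightarrow> perms \<Rightarrow> letter word set set" where
  "tails k m \<theta> = tail_words k m // tail_rel k m \<theta>"

definition tail_init ::
  "nat \<Rightarrow> (nat \<Rightarrow> nat) \<Rightarrow> perms \<Rightarrow> letter word set \<Rightarrow> (nat \<Rightarrow> nat) \<Rightarrow> letter list set" where
  "tail_init k m \<theta> \<tau> n = the_elem ((\<lambda>x. word_init k m \<theta> x n) ` \<tau>)"

definition prefix_tail ::
  "nat \<Rightarrow> (nat \<Rightarrow> nat) \<Rightarrow> perms \<Rightarrow> letter list set \<Rightarrow> letter word set \<Rightarrow> letter word set" where
  "prefix_tail k m \<theta> w \<tau> = (\<Union>u\<in>w. \<Union>x\<in>\<tau>. tail_rel k m \<theta> `` {u \<frown> x})"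

text \<open>The argument \<open>n\<close> of \<open>\<Sigma>(\<tau>, n)\<close> is meant to satisfy \<open>n \<le> 0\<close>.\<close>

definition tail_symbol ::
  "nat \<Rightarrow> (nat \<Rightarrow> nat) \<Rightarrow> perms \<Rightarrow> letter word set \<Rightarrow> (nat \<Rightarrow> int) \<Rightarrow> (nat \<Rightarrow> nat)" where
  "tail_symbol k m \<theta> \<tau> n = (let n' = (\<lambda>i. nat (- n i)) in
     (\<lambda>i\<in>{1..k}. THE t. t \<in> {1..m i} \<and>
       tail_init k m \<theta> \<tau> (n' + unit_vec i)
         = tail_init k m \<theta> \<tau> n' \<otimes>\<^bsub>semigrp k m \<theta>\<^esub> gen k m \<theta> i t))"

definition tail_periodic ::
  "nat \<Rightarrow> (nat \<Rightarrow> nat) \<Rightarrow> perms \<Rightarrow> (nat \<Rightarrow> int) \<Rightarrow> letter word set \<Rightarrow> bool" where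
  "tail_periodic k m \<theta> p \<tau> \<longleftrightarrow>
     (\<forall>n\<in>vecs k. n \<le> 0 \<and> n + p \<le> 0 \<longrightarrow>
        tail_symbol k m \<theta> \<tau> n = tail_symbol k m \<theta> \<tau> (n + p))"

definition tail_eventually_periodic ::
  "nat \<Rightarrow> (nat \<Rightarrow> nat) \<Rightarrow> perms \<Rightarrow> (nat \<Rightarrow> int) \<Rightarrow> letter word set \<Rightarrow> bool" where
  "tail_eventually_periodic k m \<theta> p \<tau> \<longleftrightarrow>
     (\<exists>T\<in>vecs k. T \<le> 0 \<and> T + p \<le> 0 \<and>
        (\<forall>n\<in>vecs k. n \<le> T \<longrightarrow> tail_symbol k m \<theta> \<tau> n = tail_symbol k m \<theta> \<tau> (n + p)))"

definition kgraph_periodic :: "nat \<Rightarrow> (nat \<Rightarrow> nat) \<Rightarrow> perms \<Rightarrow> (nat \<Rightarrow> int) \<Rightarrow> bool" where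
  "kgraph_periodic k m \<theta> p \<longleftrightarrow> (\<forall>\<tau>\<in>tails k m \<theta>. tail_eventually_periodic k m \<theta> p \<tau>)"

end

theory Submission
  imports Defs
begin

text \<open>
  Let \<open>A = (a\<^sub>1, \<dots>, a\<^sub>p, 0, \<dots>, 0)\<close> and \<open>B = (0, \<dots>, 0, b\<^sub>p\<^sub>+\<^sub>1, \<dots>, b\<^sub>p\<^sub>+\<^sub>q, 0, \<dots>, 0)\<close>. Then
  \<open>\<pi> = A - B\<close>, and since \<open>A\<close> and \<open>B\<close> have disjoint supports, the pairs of positions that
  \<open>\<pi>\<close>-periodicity compares are exactly \<open>A + n\<close> and \<open>B + n\<close> for \<open>n \<in> \<nat>\<^sub>0\<^sup>k\<close>
  (\<open>tail_periodic_iff\<close>). As the symbols of a tail determine it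
  (\<open>symbols_determine_tail\<close>), a tail is \<open>\<pi>\<close>-periodic iff removing its initial segment of degree
  \<open>A\<close> leaves the same tail as removing the one of degree \<open>B\<close>.

  \<^emph>\<open>Eventual periodicity of all tails implies periodicity.\<close> On a tail \<open>u\<^sup>\<omega>\<close> the symbols do not change
  when the position moves by a multiple of the degree of \<open>u\<close>, so for such a tail an eventual period
  is a period. A single instance of periodicity at a tail \<open>x\<close> involves only a finite initial
  segment \<open>u\<close> of \<open>x\<close>, and \<open>u\<^sup>\<omega>\<close> starts with the same segment
  (\<open>eventually_periodic_imp_periodic\<close>).

  \<^emph>\<open>Periodicity yields the bijection.\<close> Take \<open>u\<close> of degree \<open>A\<close> and \<open>v\<close> of degree \<open>B\<close>, and refactor
  \<open>uv = v'u'\<close> with \<open>v'\<close> of degree \<open>B\<close> and \<open>u'\<close> of degree \<open>A\<close>. For any tail \<open>x\<close>, removing degree \<open>A\<close>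
  from \<open>uvx = v'u'x\<close> leaves \<open>vx\<close> and removing degree \<open>B\<close> leaves \<open>u'x\<close>. So periodicity gives
  \<open>vx = u'x\<close> for all \<open>x\<close> at once (\<open>periodic_interchangeable\<close>): the same partner \<open>u'\<close> serves every
  tail. By symmetry each word of degree \<open>A\<close> has a partner of degree \<open>B\<close>, partners are unique by
  cancellation, and \<open>\<gamma>\<close> is the map to the partner. In the refactorization above, \<open>\<gamma> u' = v\<close> and
  \<open>\<gamma> u = v'\<close>, which is the identity \<open>ef = \<gamma>(e) \<gamma>\<^sup>-\<^sup>1(f)\<close>. Conversely, a partner \<open>v\<close> of the initial
  segment \<open>u\<close> of degree \<open>A\<close> turns \<open>x = uy\<close> into \<open>x = vy\<close>, so both removals leave \<open>y\<close>
  (\<open>interchangeable_imp_periodic\<close>).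

  \<^emph>\<open>The case \<open>p + q = k\<close>.\<close> The identity \<open>ef = \<gamma>(e) \<gamma>\<^sup>-\<^sup>1(f)\<close> alone rewrites \<open>ux\<close> and \<open>\<gamma>(u)x\<close> as
  \<open>w (u\<^sub>1 y)\<close> and \<open>w (\<gamma>(u\<^sub>1) y)\<close> with a common \<open>w\<close> of degree \<open>A + B\<close>. By iteration the two tails agree
  up to every multiple of \<open>A + B\<close>, and these multiples are cofinal because \<open>A + B\<close> has no zero
  coordinate (\<open>exchange_imp_interchangeable\<close>).
\<close>

section \<open>Degree vectors\<close>

lemma vecs_add [intro]: "x \<in> vecs k \<Longrightarrow> y \<in> vecs k \<Longrightarrow> x + y \<in> vecs k"
  for x y :: "nat \<Rightarrow> 'a::monoid_add"
  by (simp add: vecs_def)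

lemma vecs_diffE:
  fixes d e :: "nat \<Rightarrow> nat"
  assumes "d \<le> e" "e \<in> vecs k"
  obtains c where "c \<in> vecs k" "e = d + c"
proof
  show "(\<lambda>i. e i - d i) \<in> vecs k"
    using assms by (simp add: vecs_def)
  show "e = d + (\<lambda>i. e i - d i)"
    using assms(1) by (simp add: fun_eq_iff le_fun_def)
qed

text \<open>
  This reduces cofinality in \<open>\<nat>\<^sub>0\<^sup>k\<close> to an induction on a single natural number that bounds all
  coordinates from below.
\<close>
lemma vecs_le_of_sum_le:
  fixes n N :: "nat \<Rightarrow> nat"
  assumes "n \<in> vecs k" "\<forall>i\<in>{1..k}. sum n {1..k} \<le> N i"
  shows "n \<le> N"
proof (rule le_funI)
  fix i show "n i \<le> N i"
  proof (cases "i \<in> {1..k}")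
    case True
    then show ?thesis
      using assms(2) member_le_sum[of i "{1..k}" n] by (meson finite_atLeastAtMost le_trans zero_le)
  next
    case False
    with assms(1) show ?thesis by (simp add: vecs_def)
  qed
qed

lemma unit_vec_in_vecs: "i \<in> {1..k} \<Longrightarrow> unit_vec i \<in> vecs k"
  by (auto simp: unit_vec_def vecs_def)

section \<open>Words and the semigroup\<close>

definition color_count :: "letter list \<Rightarrow> nat \<Rightarrow> nat" where
  "color_count u = (\<lambda>i. count_list (map fst u) i)"

lemma color_count_append [simp]: "color_count (u @ v) = color_count u + color_count v"
  by (simp add: color_count_def fun_eq_iff)

lemma color_count_Nil [simp]: "color_count [] = 0"
  by (simp add: color_count_def fun_eq_iff)

lemma commute_step_color_count: "commute_step k m \<theta> u v \<Longrightarrow> color_count u = color_count v"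
  by (induction rule: commute_step.induct) (auto simp: color_count_def fun_eq_iff)

lemma commute_step_append: "commute_step k m \<theta> u v \<Longrightarrow> commute_step k m \<theta> (a @ u @ b) (a @ v @ b)"
proof (induction rule: commute_step.induct)
  case (1 i j s t s' t' u v)
  then show ?case
    using commute_step.intros[of i j k s m t \<theta> s' t' "a @ u" "v @ b"] by simp
qed

lemma equivclp_commute_step_append:
  assumes "equivclp (commute_step k m \<theta>) u v"
  shows "equivclp (commute_step k m \<theta>) (a @ u @ b) (a @ v @ b)"
  using assms
proof (induction rule: equivclp_induct)
  case (step y z)
  then show ?case by (meson commute_step_append equivclp_into_equivclp)
qed simp

text \<open>A commutation needs two letters; this is what makes distinct generators distinct elements.\<close>
lemma equivclp_commute_step_singleton: "equivclp (commute_step k m \<theta>) [l] v \<Longrightarrow> v = [l]"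
proof (induction rule: equivclp_induct)
  case (step y z)
  then show ?case by (auto elim!: commute_step.cases simp: append_eq_Cons_conv Cons_eq_append_conv)
qed simp

context single_vertex_kgraph
begin

abbreviation words :: "letter list set" where "words \<equiv> lists (letters k m)"

abbreviation word_equiv :: "letter list \<Rightarrow> letter list \<Rightarrow> bool" (infix "\<approx>" 50) where
  "u \<approx> v \<equiv> (u, v) \<in> word_rel k m \<theta>"

abbreviation cls :: "letter list \<Rightarrow> letter list set" where "cls \<equiv> word_class k m \<theta>"

abbreviation S :: "letter list set monoid" where "S \<equiv> semigrp k m \<theta>"

lemma equiv_word_rel: "equiv words (word_rel k m \<theta>)"
  by (rule equivI) (auto simp: word_rel_def refl_on_def sym_def trans_def
      intro: equivclp_sym equivclp_trans)

lemma word_equivD: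
  assumes "u \<approx> v"
  shows "u \<in> words" "v \<in> words" "color_count u = color_count v"
proof -
  have "equivclp (commute_step k m \<theta>) u v"
    using assms by (simp add: word_rel_def)
  then show "color_count u = color_count v"
    by (induction rule: equivclp_induct) (auto dest: commute_step_color_count)
qed (use assms in \<open>auto simp: word_rel_def\<close>)

lemma word_equiv_refl [intro]: "u \<in> words \<Longrightarrow> u \<approx> u"
  by (simp add: word_rel_def)

lemma word_equiv_sym: "u \<approx> v \<Longrightarrow> v \<approx> u"
  by (auto simp: word_rel_def intro: equivclp_sym)

lemma word_equiv_trans [trans]: "u \<approx> v \<Longrightarrow> v \<approx> w \<Longrightarrow> u \<approx> w"
  by (auto simp: word_rel_def intro: equivclp_trans)

lemma word_equiv_append:
  assumes "u \<approx> u'" "v \<approx> v'"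
  shows "u @ v \<approx> u' @ v'"
proof -
  have "equivclp (commute_step k m \<theta>) (u @ v) (u' @ v)"
    using assms equivclp_commute_step_append[of k m \<theta> u u' "[]" v] by (simp add: word_rel_def)
  moreover have "equivclp (commute_step k m \<theta>) (u' @ v) (u' @ v')"
    using assms equivclp_commute_step_append[of k m \<theta> v v' u' "[]"] by (simp add: word_rel_def)
  ultimately show ?thesis
    using assms by (auto simp: word_rel_def intro: equivclp_trans)
qed

lemma cls_eq_iff: "u \<in> words \<Longrightarrow> v \<in> words \<Longrightarrow> cls u = cls v \<longleftrightarrow> u \<approx> v"
  unfolding word_class_def by (rule eq_equiv_class_iff[OF equiv_word_rel])

lemma carrier_iff: "w \<in> carrier S \<longleftrightarrow> (\<exists>u\<in>words. w = cls u)"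
  by (auto simp: semigrp_def word_class_def quotient_def)

lemma carrierE:
  assumes "w \<in> carrier S"
  obtains u where "u \<in> words" "w = cls u"
  using assms carrier_iff by auto

lemma cls_in_carrier [intro]: "u \<in> words \<Longrightarrow> cls u \<in> carrier S"
  using carrier_iff by blast

lemma mult_cls:
  assumes "u \<in> words" "v \<in> words"
  shows "cls u \<otimes>\<^bsub>S\<^esub> cls v = cls (u @ v)"
proof -
  have "cls (a @ b) = cls (u @ v)" if "a \<in> cls u" "b \<in> cls v" for a b
  proof -
    have "u @ v \<approx> a @ b"
      using that by (intro word_equiv_append) (auto simp: word_class_def)
    then show ?thesis
      using cls_eq_iff word_equivD by metis
  qed
  moreover have "u \<in> cls u" "v \<in> cls v"
    using assms by (auto simp: word_class_def)
  ultimately have "(\<Union>a\<in>cls u. \<Union>b\<in>cls v. cls (a @ b)) = cls (u @ v)"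
    by blast
  then show ?thesis
    by (simp add: semigrp_def)
qed

lemma deg_cls:
  assumes "u \<in> words"
  shows "deg (cls u) = color_count u"
proof -
  have "(\<lambda>v i. count_list (map fst v) i) ` cls u = {color_count u}"
    using assms word_equivD(3) unfolding color_count_def[symmetric]
    by (auto simp: word_class_def)
  then show ?thesis by (simp add: deg_def)
qed

lemma color_count_vecs [intro]: "u \<in> words \<Longrightarrow> color_count u \<in> vecs k"
  by (force simp: color_count_def vecs_def letters_def count_list_0_iff)

text \<open>
  Existence of factorizations for representatives. Working with words up to \<open>\<approx>\<close> makes products
  plain concatenations, which are associative without further argument.
\<close>
lemma word_factor_exists:
  assumes "u \<in> words" "d \<in> vecs k" "d' \<in> vecs k" "color_count u = d + d'"
  obtains v w where "v \<in> words" "w \<in> words" "u \<approx> v @ w" "color_count v = d" "color_count w = d'"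
proof -
  have "deg (cls u) = d + d'"
    using assms deg_cls by simp
  then obtain a b where ab: "a \<in> carrier S" "b \<in> carrier S" "cls u = a \<otimes>\<^bsub>S\<^esub> b" "deg a = d" "deg b = d'"
    using unique_factorization[OF cls_in_carrier[OF assms(1)] assms(2,3)] by blast
  obtain v w where "v \<in> words" "w \<in> words" "a = cls v" "b = cls w"
    using ab carrierE by metis
  with ab assms(1) that show thesis
    by (auto simp: mult_cls deg_cls cls_eq_iff)
qed

text \<open>Only the degrees of the left factors are compared: those of the right factors then agree as well.\<close>
lemma word_factor_unique:
  assumes "v @ w \<approx> v' @ w'" "color_count v = color_count v'"
  shows "v \<approx> v'" "w \<approx> w'"
proof -
  have mem: "v \<in> words" "w \<in> words" "v' \<in> words" "w' \<in> words"
    using word_equivD[OF assms(1)] by auto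
  have "color_count v + color_count w = color_count v' + color_count w'"
    using word_equivD(3)[OF assms(1)] by simp
  then have cw: "color_count w = color_count w'"
    using assms(2) by simp
  let ?P = "\<lambda>(a, b). a \<in> carrier S \<and> b \<in> carrier S \<and> cls (v @ w) = a \<otimes>\<^bsub>S\<^esub> b
      \<and> deg a = color_count v \<and> deg b = color_count w"
  have "\<exists>!x. ?P x"
    using mem by (intro unique_factorization cls_in_carrier color_count_vecs) (auto simp: deg_cls)
  moreover have "?P (cls v, cls w)" "?P (cls v', cls w')"
    using mem assms cw by (auto simp: deg_cls mult_cls cls_eq_iff)
  ultimately have "(cls v, cls w) = (cls v', cls w')"
    by blast
  then show "v \<approx> v'" "w \<approx> w'"
    using mem by (auto simp: cls_eq_iff)
qed

section \<open>Initial segments of tails\<close>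

abbreviation "TW \<equiv> tail_words k m"

abbreviation tail_equiv :: "letter word \<Rightarrow> letter word \<Rightarrow> bool" (infix "\<simeq>" 50) where
  "x \<simeq> y \<equiv> (x, y) \<in> tail_rel k m \<theta>"

abbreviation init :: "letter word \<Rightarrow> (nat \<Rightarrow> nat) \<Rightarrow> letter list set" where
  "init \<equiv> word_init k m \<theta>"

lemma prefix_in_words [intro]: "x \<in> TW \<Longrightarrow> prefix N x \<in> words"
  by (auto simp: tail_words_def)

lemma prefix_decompose: "N \<le> M \<Longrightarrow> prefix M x = prefix N x @ (x [N \<rightarrow> M])"
  using subsequence_append[of x N "M - N"] by simp

lemma suffix_in_TW:
  assumes "x \<in> TW"
  shows "suffix N x \<in> TW"
proof -
  have "infinite {r. fst (x (N + r)) = i}" if "i \<in> {1..k}" for i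
  proof
    assume "finite {r. fst (x (N + r)) = i}"
    then have "finite ((+) N ` {r. fst (x (N + r)) = i} \<union> {..<N})" by simp
    moreover have "{r. fst (x r) = i} \<subseteq> (+) N ` {r. fst (x (N + r)) = i} \<union> {..<N}"
    proof
      fix r assume "r \<in> {r. fst (x r) = i}"
      then show "r \<in> (+) N ` {r. fst (x (N + r)) = i} \<union> {..<N}"
        by (cases "r < N") (auto simp: image_iff intro!: exI[of _ "r - N"])
    qed
    ultimately have "finite {r. fst (x r) = i}"
      by (rule finite_subset[rotated])
    with assms that show False
      by (auto simp: tail_words_def)
  qed
  with assms show ?thesis
    by (auto simp: tail_words_def)
qed

lemma conc_in_TW:
  assumes "u \<in> words" "x \<in> TW"
  shows "u \<frown> x \<in> TW"
proof -
  have "infinite {r. fst ((u \<frown> x) r) = i}" if "i \<in> {1..k}" for i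
  proof
    assume fin: "finite {r. fst ((u \<frown> x) r) = i}"
    have "(+) (length u) ` {r. fst (x r) = i} \<subseteq> {r. fst ((u \<frown> x) r) = i}"
      by auto
    with fin have "finite ((+) (length u) ` {r. fst (x r) = i})"
      using finite_subset by blast
    then have "finite {r. fst (x r) = i}"
      by (rule finite_imageD) simp
    with assms that show False
      by (auto simp: tail_words_def)
  qed
  moreover have "(u \<frown> x) r \<in> letters k m" for r
    using assms by (cases "r < length u") (auto simp: tail_words_def in_lists_conv_set)
  ultimately show ?thesis
    by (auto simp: tail_words_def)
qed

text \<open>
  Each color occurs infinitely often, so each coordinate of the degree of a prefix grows without
  bound; a prefix that is long enough for every color has length at most the sum of the lengths
  that are needed for the single colors.
\<close>
lemma exists_prefix_color_count_ge:
  assumes "x \<in> TW" "n \<in> vecs k"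
  obtains N where "n \<le> color_count (prefix N x)"
proof -
  have mono: "color_count (prefix N x) i \<le> color_count (prefix M x) i" if "N \<le> M" for N M i
    using prefix_decompose[OF that, of x] by simp
  have "\<exists>N. c \<le> color_count (prefix N x) i" if "i \<in> {1..k}" for i c
  proof (induction c)
    case (Suc c)
    then obtain N where N: "c \<le> color_count (prefix N x) i" by blast
    have "infinite {r. fst (x r) = i}"
      using assms that by (auto simp: tail_words_def)
    then obtain r where "r \<ge> N" "fst (x r) = i"
      unfolding infinite_nat_iff_unbounded_le by blast
    with N mono[of N r i] have "Suc c \<le> color_count (prefix (Suc r) x) i"
      by (simp add: color_count_def)
    then show ?case by blast
  qed simp
  then have "\<forall>i\<in>{1..k}. \<exists>N. n i \<le> color_count (prefix N x) i"
    by blast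
  then obtain f where f: "\<And>i. i \<in> {1..k} \<Longrightarrow> n i \<le> color_count (prefix (f i) x) i"
    using bchoice[of "{1..k}" "\<lambda>i N. n i \<le> color_count (prefix N x) i"] by blast
  have "n i \<le> color_count (prefix (\<Sum>i\<in>{1..k}. f i) x) i" for i
  proof (cases "i \<in> {1..k}")
    case True
    then show ?thesis
      using f[OF True] mono[of "f i" "\<Sum>i\<in>{1..k}. f i" i] member_le_sum[of i "{1..k}" f]
      by (meson finite_atLeastAtMost le_trans zero_le)
  next
    case False
    then show ?thesis using assms(2) by (simp add: vecs_def)
  qed
  then show thesis by (intro that le_funI)
qed

text \<open>
  Two prefixes of a word are comparable, so left factors of equal degree of two prefixes are left
  factors of the longer one, and unique factorization identifies them. This makes the definite
  description in the initial segment well defined and lets any prefix compute it.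
\<close>
lemma word_init_eqI:
  assumes "x \<in> TW" "u \<in> words" "v \<in> words" "prefix N x \<approx> u @ v"
  shows "init x (color_count u) = cls u"
  unfolding word_init_def
proof (rule the_equality)
  show "cls u \<in> carrier S \<and> deg (cls u) = color_count u \<and>
      (\<exists>N. \<exists>v\<in>carrier S. cls (prefix N x) = cls u \<otimes>\<^bsub>S\<^esub> v)"
    using assms by (metis cls_in_carrier deg_cls mult_cls cls_eq_iff word_equivD(1,2))
next
  fix w
  assume w: "w \<in> carrier S \<and> deg w = color_count u \<and>
      (\<exists>N. \<exists>v\<in>carrier S. cls (prefix N x) = w \<otimes>\<^bsub>S\<^esub> v)"
  then obtain M u' v' where 1: "u' \<in> words" "w = cls u'" "v' \<in> words"
      "cls (prefix M x) = w \<otimes>\<^bsub>S\<^esub> cls v'"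
    by (metis carrierE)
  then have 2: "prefix M x \<approx> u' @ v'" "color_count u' = color_count u"
    using assms w by (auto simp: mult_cls cls_eq_iff deg_cls prefix_in_words)
  let ?L = "max M N"
  have "x [A \<rightarrow> ?L] \<in> words" for A
    using assms(1) by (auto simp: tail_words_def)
  then have "prefix ?L x \<approx> (u' @ v') @ (x [M \<rightarrow> ?L])" "prefix ?L x \<approx> (u @ v) @ (x [N \<rightarrow> ?L])"
    using 2 assms prefix_decompose[of M ?L x] prefix_decompose[of N ?L x]
    by (metis max.cobounded1 max.cobounded2 word_equiv_append word_equiv_refl)+
  then have "u' @ (v' @ (x [M \<rightarrow> ?L])) \<approx> u @ (v @ (x [N \<rightarrow> ?L]))"
    by (metis append.assoc word_equiv_sym word_equiv_trans)
  then show "w = cls u"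
    using 1 2 assms cls_eq_iff word_factor_unique(1) by metis
qed

lemma word_initE:
  assumes "x \<in> TW" "n \<in> vecs k"
  obtains N u v where "u \<in> words" "v \<in> words" "prefix N x \<approx> u @ v" "color_count u = n" "init x n = cls u"
proof -
  obtain N where N: "n \<le> color_count (prefix N x)"
    using exists_prefix_color_count_ge assms .
  then obtain d where d: "d \<in> vecs k" "color_count (prefix N x) = n + d"
    using vecs_diffE color_count_vecs prefix_in_words assms(1) by metis
  then obtain u v where "u \<in> words" "v \<in> words" "prefix N x \<approx> u @ v" "color_count u = n"
    using word_factor_exists[of "prefix N x" n d] prefix_in_words[OF assms(1)] assms(2) by metis
  then show thesis
    using that word_init_eqI[OF assms(1)] by metis
qed

section \<open>Prefixing and shifting tails\<close>

lemma tail_equivD: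
  assumes "x \<simeq> y"
  shows "x \<in> TW" "y \<in> TW" "n \<in> vecs k \<Longrightarrow> init x n = init y n"
  using assms by (auto simp: tail_rel_def)

lemma equiv_tail_rel: "equiv TW (tail_rel k m \<theta>)"
  by (rule equivI) (auto simp: tail_rel_def refl_on_def sym_def trans_def)

lemma tail_equiv_refl [intro]: "x \<in> TW \<Longrightarrow> x \<simeq> x"
  by (simp add: tail_rel_def)

lemma tail_equiv_sym: "x \<simeq> y \<Longrightarrow> y \<simeq> x"
  by (auto simp: tail_rel_def)

lemma tail_equiv_trans [trans]: "x \<simeq> y \<Longrightarrow> y \<simeq> z \<Longrightarrow> x \<simeq> z"
  by (auto simp: tail_rel_def)

lemma init_conc:
  assumes "u \<in> words" "x \<in> TW" "n \<in> vecs k"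
  shows "init (u \<frown> x) (color_count u + n) = cls u \<otimes>\<^bsub>S\<^esub> init x n"
proof -
  obtain N a b where ab: "a \<in> words" "b \<in> words" "prefix N x \<approx> a @ b" "color_count a = n" "init x n = cls a"
    using word_initE assms(2,3) .
  have "u @ prefix N x \<approx> u @ (a @ b)"
    using assms(1) ab(3) by (intro word_equiv_append) auto
  then have "prefix (length u + N) (u \<frown> x) \<approx> (u @ a) @ b"
    by simp
  then have "init (u \<frown> x) (color_count (u @ a)) = cls (u @ a)"
    using ab(1,2) assms by (intro word_init_eqI[where v = b and N = "length u + N"] conc_in_TW) auto
  with ab assms(1) show ?thesis
    by (simp add: mult_cls)
qed

text \<open>A left factor of the initial segment of degree \<open>n'\<close> is itself an initial segment.\<close>
lemma init_eq_mono:
  assumes "x \<in> TW" "y \<in> TW" "n' \<in> vecs k" "n \<le> n'" "init x n' = init y n'"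
  shows "init x n = init y n"
proof -
  obtain N u v where u: "u \<in> words" "v \<in> words" "prefix N x \<approx> u @ v" "color_count u = n'" "init x n' = cls u"
    using word_initE assms(1,3) .
  obtain N' u' v' where u': "u' \<in> words" "v' \<in> words" "prefix N' y \<approx> u' @ v'" "init y n' = cls u'"
    using word_initE assms(2,3) .
  have uu': "u' \<approx> u"
    using u u' assms(5) by (metis cls_eq_iff)
  obtain d where "d \<in> vecs k" "n' = n + d"
    using vecs_diffE assms(4,3) .
  moreover from this assms(3) have "n \<in> vecs k"
    by (simp add: vecs_def)
  ultimately obtain a b where ab: "a \<in> words" "b \<in> words" "u \<approx> a @ b" "color_count a = n"
    using word_factor_exists u(1,4) by metis
  have "prefix N x \<approx> (a @ b) @ v" "prefix N' y \<approx> (a @ b) @ v'"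
    using u u' uu' ab by (meson word_equiv_append word_equiv_refl word_equiv_trans)+
  then have "init x (color_count a) = cls a" "init y (color_count a) = cls a"
    using ab(1,2) u(2) u'(2) assms(1,2) word_init_eqI[of x a "b @ v" N] word_init_eqI[of y a "b @ v'" N']
    by auto
  with ab show ?thesis by simp
qed

lemma tail_equivI:
  assumes "x \<in> TW" "y \<in> TW"
    and "\<And>n. n \<in> vecs k \<Longrightarrow> \<exists>n'\<in>vecs k. n \<le> n' \<and> init x n' = init y n'"
  shows "x \<simeq> y"
proof -
  have "init x n = init y n" if "n \<in> vecs k" for n
    using assms(3)[OF that] init_eq_mono[OF assms(1,2)] by blast
  with assms(1,2) show ?thesis
    by (simp add: tail_rel_def)
qed

text \<open>
  Initial segments of degree at least that of \<open>u\<close> determine the smaller ones, so it is enough to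
  look at degrees of the form \<open>deg u + n\<close>, where prefixing is multiplication.
\<close>
lemma conc_cong:
  assumes "u \<approx> u'" "x \<simeq> x'"
  shows "u \<frown> x \<simeq> u' \<frown> x'"
proof (rule tail_equivI)
  show "u \<frown> x \<in> TW" "u' \<frown> x' \<in> TW"
    using assms conc_in_TW tail_equivD word_equivD by auto
next
  fix n :: "nat \<Rightarrow> nat"
  assume n: "n \<in> vecs k"
  have "init (u \<frown> x) (color_count u + n) = init (u' \<frown> x') (color_count u + n)"
    using init_conc[of u x n] init_conc[of u' x' n] assms n tail_equivD[OF assms(2)] word_equivD[OF assms(1)]
    by (metis cls_eq_iff)
  moreover have "color_count u + n \<in> vecs k" "n \<le> color_count u + n"
    using n color_count_vecs word_equivD[OF assms(1)] by (auto simp: le_fun_def)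
  ultimately show "\<exists>n'\<in>vecs k. n \<le> n' \<and> init (u \<frown> x) n' = init (u' \<frown> x') n'"
    by blast
qed

lemma conc_cancel:
  assumes "u \<frown> x \<simeq> u' \<frown> x'" "u \<in> words" "u' \<in> words" "x \<in> TW" "x' \<in> TW"
    and "color_count u = color_count u'"
  shows "u \<approx> u'" "x \<simeq> x'"
proof -
  have *: "u \<approx> u' \<and> init x n = init x' n" if n: "n \<in> vecs k" for n
  proof -
    obtain a where a: "a \<in> words" "init x n = cls a"
      using word_initE assms(4) n .
    obtain a' where a': "a' \<in> words" "init x' n = cls a'"
      using word_initE assms(5) n .
    have "init (u \<frown> x) (color_count u + n) = init (u' \<frown> x') (color_count u' + n)"
      using tail_equivD(3)[OF assms(1), of "color_count u + n"] assms n by auto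
    then have "cls (u @ a) = cls (u' @ a')"
      using init_conc[OF assms(2,4) n] init_conc[OF assms(3,5) n] a a' assms(2,3)
      by (simp only: mult_cls)
    then have "u @ a \<approx> u' @ a'"
      using cls_eq_iff[of "u @ a" "u' @ a'"] assms(2,3) a(1) a'(1) by simp
    with word_factor_unique[OF this assms(6)] a a' show ?thesis
      by (simp add: cls_eq_iff)
  qed
  then show "x \<simeq> x'"
    using assms by (simp add: tail_rel_def)
  have "0 \<in> vecs k"
    by (simp add: vecs_def)
  with * show "u \<approx> u'" by blast
qed

text \<open>
  The tail \<open>y\<close> is the result of removing the initial segment \<open>u\<close> of degree \<open>d\<close> from \<open>x\<close>: a long
  prefix of \<open>x\<close> is refactored as \<open>uv\<close>, and \<open>v\<close> is put back in front of the rest.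
\<close>
lemma tail_split:
  assumes "x \<in> TW" "d \<in> vecs k"
  obtains u y where "u \<in> words" "y \<in> TW" "color_count u = d" "x \<simeq> u \<frown> y"
proof -
  obtain N u v where u: "u \<in> words" "v \<in> words" "prefix N x \<approx> u @ v" "color_count u = d"
    using word_initE assms .
  have suf: "suffix N x \<in> TW"
    using suffix_in_TW assms(1) .
  have "prefix N x \<frown> suffix N x \<simeq> (u @ v) \<frown> suffix N x"
    using u(3) suf by (intro conc_cong) auto
  then have "x \<simeq> u \<frown> (v \<frown> suffix N x)"
    by simp
  with that[of u "v \<frown> suffix N x"] u suf conc_in_TW show thesis
    by blast
qed

section \<open>Symbols and periodicity\<close>

text \<open>The value of \<open>\<Sigma>\<close> at the position \<open>- n\<close> of the tail represented by \<open>x\<close>.\<close>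
definition symbol :: "letter word \<Rightarrow> (nat \<Rightarrow> nat) \<Rightarrow> nat \<Rightarrow> nat" where
  "symbol x n = (\<lambda>i\<in>{1..k}. THE t. t \<in> {1..m i} \<and>
     init x (n + unit_vec i) = init x n \<otimes>\<^bsub>S\<^esub> gen k m \<theta> i t)"

lemma monochromatic_word:
  assumes "u \<in> words" "color_count u = (\<lambda>j. if j = i then c else 0)"
  obtains s where "s \<in> lists {1..m i}" "length s = c" "u = map (Pair i) s"
proof
  have col: "fst l = i" if "l \<in> set u" for l
  proof (rule ccontr)
    assume "fst l \<noteq> i"
    then have "count_list (map fst u) (fst l) = 0"
      using fun_cong[OF assms(2), of "fst l"] by (simp add: color_count_def)
    with that show False by (auto simp: count_list_0_iff)
  qed
  show u: "u = map (Pair i) (map snd u)"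
    unfolding map_map o_def using col by (intro map_idI[symmetric]) (simp add: prod_eq_iff)
  show "map snd u \<in> lists {1..m i}"
    using assms(1) col by (fastforce simp: letters_def in_lists_conv_set)
  have "\<forall>l\<in>set (map fst u). l = i"
    using col by auto
  then have "map fst u = replicate (length u) i"
    by (metis replicate_eqI length_map)
  then have "color_count u i = length u"
    by (auto simp: color_count_def count_list_eq_length_filter)
  with assms(2) show "length (map snd u) = c"
    by simp
qed

lemma letter_word_equiv_iff: "[l] \<approx> [l'] \<longleftrightarrow> l = l' \<and> l \<in> letters k m"
  using equivclp_commute_step_singleton[of k m \<theta> l "[l']"] by (auto simp: word_rel_def)

text \<open>
  The initial segment of degree \<open>n + \<epsilon>\<^sub>i\<close> factors as one of degree \<open>n\<close> followed by a word of degree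
  \<open>\<epsilon>\<^sub>i\<close>, which is a single letter of color \<open>i\<close>; by cancellation this letter is unique.
\<close>
lemma symbol_char:
  assumes "x \<in> TW" "n \<in> vecs k" "i \<in> {1..k}"
  shows "symbol x n i \<in> {1..m i}"
    and "init x (n + unit_vec i) = init x n \<otimes>\<^bsub>S\<^esub> gen k m \<theta> i (symbol x n i)"
    and "t \<in> {1..m i} \<Longrightarrow> init x (n + unit_vec i) = init x n \<otimes>\<^bsub>S\<^esub> gen k m \<theta> i t \<Longrightarrow> symbol x n i = t"
proof -
  let ?P = "\<lambda>t. t \<in> {1..m i} \<and> init x (n + unit_vec i) = init x n \<otimes>\<^bsub>S\<^esub> gen k m \<theta> i t"
  have vec: "n + unit_vec i \<in> vecs k"
    using assms unit_vec_in_vecs by blast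
  obtain N u v where u: "u \<in> words" "v \<in> words" "prefix N x \<approx> u @ v"
      "color_count u = n + unit_vec i" "init x (n + unit_vec i) = cls u"
    using word_initE assms(1) vec .
  then obtain a b where ab: "a \<in> words" "b \<in> words" "u \<approx> a @ b" "color_count a = n" "color_count b = unit_vec i"
    using word_factor_exists assms(2) unit_vec_in_vecs[OF assms(3)] by metis
  obtain s where "s \<in> lists {1..m i}" "length s = 1" "b = map (Pair i) s"
    using monochromatic_word[OF ab(2), of i 1] ab(5) by (auto simp: unit_vec_def)
  then obtain t0 where t0: "t0 \<in> {1..m i}" "b = [(i, t0)]"
    by (auto simp: length_Suc_conv)
  have ltr: "[(i, t)] \<in> words" if "t \<in> {1..m i}" for t
    using that assms(3) by (auto simp: letters_def)
  have "prefix N x \<approx> (a @ b) @ v"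
    using u ab by (meson word_equiv_append word_equiv_refl word_equiv_trans)
  then have init: "init x n = cls a"
    using word_init_eqI[OF assms(1) ab(1), of "b @ v" N] ab(2,4) u(2) by auto
  have iff: "?P t \<longleftrightarrow> t \<in> {1..m i} \<and> t = t0" for t
  proof (cases "t \<in> {1..m i}")
    case True
    have "cls a \<otimes>\<^bsub>S\<^esub> gen k m \<theta> i t = cls (a @ [(i, t)])"
      unfolding gen_def by (rule mult_cls) (use ab(1) ltr[OF True] in auto)
    then have "?P t \<longleftrightarrow> cls u = cls (a @ [(i, t)])"
      using True init u(5) by simp
    also have "\<dots> \<longleftrightarrow> u \<approx> a @ [(i, t)]"
      using cls_eq_iff u(1) ab(1) ltr[OF True] by auto
    also have "\<dots> \<longleftrightarrow> a @ [(i, t0)] \<approx> a @ [(i, t)]"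
      using ab(3) t0(2) by (metis word_equiv_sym word_equiv_trans)
    also have "\<dots> \<longleftrightarrow> [(i, t0)] \<approx> [(i, t)]"
      using word_factor_unique(2) word_equiv_append ab(1) by blast
    finally show ?thesis
      using True t0 assms(3) by (auto simp: letter_word_equiv_iff letters_def)
  qed blast
  have "symbol x n i = (THE t. ?P t)"
    using assms(3) by (simp add: symbol_def)
  also have "\<dots> = t0"
    unfolding iff using t0(1) by (intro the_equality) auto
  finally have sym: "symbol x n i = t0" .
  show "symbol x n i \<in> {1..m i}"
    "init x (n + unit_vec i) = init x n \<otimes>\<^bsub>S\<^esub> gen k m \<theta> i (symbol x n i)"
    using iff[of t0] t0 sym by auto
  show "symbol x n i = t" if "t \<in> {1..m i}" "init x (n + unit_vec i) = init x n \<otimes>\<^bsub>S\<^esub> gen k m \<theta> i t"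
    using iff[of t] that sym by auto
qed

lemma symbol_shift:
  assumes "x \<simeq> u \<frown> y" "u \<in> words" "y \<in> TW" "n \<in> vecs k"
  shows "symbol x (color_count u + n) = symbol y n"
proof
  fix i
  show "symbol x (color_count u + n) i = symbol y n i"
  proof (cases "i \<in> {1..k}")
    case False
    then show ?thesis by (auto simp: symbol_def)
  next
    case True
    let ?t = "symbol y n i"
    have t: "?t \<in> {1..m i}" "init y (n + unit_vec i) = init y n \<otimes>\<^bsub>S\<^esub> gen k m \<theta> i ?t"
      using symbol_char assms True by auto
    have vec: "n + unit_vec i \<in> vecs k" "color_count u + n \<in> vecs k"
      using assms True unit_vec_in_vecs by blast+
    then have vec': "color_count u + (n + unit_vec i) \<in> vecs k"
      using assms(2) by blast
    have ltr: "[(i, ?t)] \<in> words"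
      using t(1) True by (auto simp: letters_def)
    obtain a where a: "a \<in> words" "init y n = cls a"
      using word_initE assms(3,4) .
    have "init x (color_count u + n + unit_vec i) = init (u \<frown> y) (color_count u + (n + unit_vec i))"
      using tail_equivD(3)[OF assms(1) vec'] by (simp add: add.assoc)
    also have "\<dots> = cls u \<otimes>\<^bsub>S\<^esub> (init y n \<otimes>\<^bsub>S\<^esub> gen k m \<theta> i ?t)"
      using init_conc assms vec t by simp
    also have "\<dots> = cls u \<otimes>\<^bsub>S\<^esub> init y n \<otimes>\<^bsub>S\<^esub> gen k m \<theta> i ?t"
      using a ltr assms(2) unfolding gen_def by (simp add: mult_cls)
    also have "cls u \<otimes>\<^bsub>S\<^esub> init y n = init x (color_count u + n)"
      using init_conc assms tail_equivD(3)[OF assms(1) vec(2)] by simp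
    finally show ?thesis
      using symbol_char(3) assms tail_equivD(1) vec(2) True t(1) by blast
  qed
qed

lemma init_zero:
  assumes "x \<in> TW"
  shows "init x 0 = cls []"
  using word_init_eqI[of x "[]" "[]" 0] assms by (auto simp: word_rel_def)

text \<open>Initial segments are rebuilt from the symbols one generator at a time.\<close>
lemma symbols_determine_tail:
  assumes "x \<in> TW" "y \<in> TW" "\<And>n. n \<in> vecs k \<Longrightarrow> symbol x n = symbol y n"
  shows "x \<simeq> y"
proof -
  have "init x n = init y n" if "n \<in> vecs k" "sum n {1..k} = c" for n c
    using that
  proof (induction c arbitrary: n)
    case 0
    then have "n = 0"
      by (auto simp: vecs_def fun_eq_iff)
    then show ?case using init_zero assms by metis
  next
    case (Suc c)
    then obtain i where i: "i \<in> {1..k}" "n i > 0"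
      by (metis gr_zeroI sum.neutral Zero_not_Suc)
    define n' where "n' = (\<lambda>j. n j - unit_vec i j)"
    have n: "n = n' + unit_vec i"
      using i by (auto simp: n'_def unit_vec_def fun_eq_iff)
    have n': "n' \<in> vecs k"
      using Suc.prems by (simp add: n'_def vecs_def)
    have "sum n {1..k} = sum n' {1..k} + sum (unit_vec i) {1..k}"
      by (simp add: n sum.distrib)
    also have "sum (unit_vec i) {1..k} = 1"
      using i by (simp add: unit_vec_def)
    finally have "init x n' = init y n'"
      using Suc n' by simp
    then show ?case
      unfolding n
      using symbol_char(2)[OF assms(1) n' i(1)] symbol_char(2)[OF assms(2) n' i(1)] assms(3)[OF n']
      by metis
  qed
  then show ?thesis
    using assms by (auto simp: tail_rel_def)
qed

abbreviation tcls :: "letter word \<Rightarrow> letter word set" where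
  "tcls x \<equiv> tail_rel k m \<theta> `` {x}"

lemma tails_iff: "\<tau> \<in> tails k m \<theta> \<longleftrightarrow> (\<exists>x\<in>TW. \<tau> = tcls x)"
  by (auto simp: tails_def quotient_def)

lemma tail_init_tcls:
  assumes "x \<in> TW" "n \<in> vecs k"
  shows "tail_init k m \<theta> (tcls x) n = init x n"
proof -
  have "(\<lambda>y. init y n) ` tcls x = {init x n}"
    using assms by (auto simp: tail_rel_def)
  then show ?thesis
    by (simp add: tail_init_def)
qed

lemma tail_symbol_tcls:
  assumes "x \<in> TW" "n \<in> vecs k"
  shows "tail_symbol k m \<theta> (tcls x) (\<lambda>i. - int (n i)) = symbol x n"
  unfolding tail_symbol_def symbol_def Let_def
  by (rule restrict_ext)
    (use assms unit_vec_in_vecs in \<open>simp add: tail_init_tcls vecs_add\<close>)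

text \<open>
  If \<open>N\<close> and \<open>N - (A - B)\<close> are both nonnegative, then \<open>N \<ge> A\<close>, because \<open>B\<close> vanishes wherever \<open>A\<close>
  does not. Hence the positions to be compared are exactly \<open>A + n\<close> and \<open>B + n\<close>.
\<close>
lemma tail_periodic_iff:
  assumes "x \<in> TW" "A \<in> vecs k" "B \<in> vecs k" "\<And>i. A i = 0 \<or> B i = 0"
    and \<pi>: "\<pi> = (\<lambda>i. int (A i) - int (B i))"
  shows "tail_periodic k m \<theta> \<pi> (tcls x) \<longleftrightarrow> (\<forall>n\<in>vecs k. symbol x (A + n) = symbol x (B + n))"
proof
  assume per: "tail_periodic k m \<theta> \<pi> (tcls x)"
  show "\<forall>n\<in>vecs k. symbol x (A + n) = symbol x (B + n)"
  proof
    fix n :: "nat \<Rightarrow> nat" assume n: "n \<in> vecs k"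
    let ?n = "\<lambda>i. - int ((A + n) i)"
    have sum: "?n + \<pi> = (\<lambda>i. - int ((B + n) i))"
      by (simp add: \<pi> fun_eq_iff)
    have "?n \<in> vecs k" "?n \<le> 0" "?n + \<pi> \<le> 0"
      unfolding sum using n assms(2) by (auto simp: vecs_def le_fun_def)
    then have "tail_symbol k m \<theta> (tcls x) ?n = tail_symbol k m \<theta> (tcls x) (?n + \<pi>)"
      using per unfolding tail_periodic_def by blast
    then show "symbol x (A + n) = symbol x (B + n)"
      unfolding sum using tail_symbol_tcls assms(1-3) n vecs_add by metis
  qed
next
  assume sym: "\<forall>n\<in>vecs k. symbol x (A + n) = symbol x (B + n)"
  show "tail_periodic k m \<theta> \<pi> (tcls x)"
    unfolding tail_periodic_def
  proof (intro ballI impI)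
    fix n :: "nat \<Rightarrow> int" assume n: "n \<in> vecs k" "n \<le> 0 \<and> n + \<pi> \<le> 0"
    define N where "N = (\<lambda>i. nat (- n i) - A i)"
    have N: "N \<in> vecs k"
      using n(1) by (simp add: N_def vecs_def)
    have *: "n i = - int ((A + N) i) \<and> n i + \<pi> i = - int ((B + N) i)" for i
    proof -
      have "n i \<le> 0" "n i + \<pi> i \<le> 0"
        using n(2) by (auto simp: le_fun_def)
      then show ?thesis
        using assms(4)[of i] by (auto simp: N_def \<pi>)
    qed
    have "n = (\<lambda>i. - int ((A + N) i))"
      using * by blast
    moreover have "n + \<pi> = (\<lambda>i. - int ((B + N) i))"
      by (rule ext) (simp only: plus_fun_apply[of n \<pi>] *[THEN conjunct2])
    ultimately show "tail_symbol k m \<theta> (tcls x) n = tail_symbol k m \<theta> (tcls x) (n + \<pi>)"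
      using sym N tail_symbol_tcls assms(1-3) vecs_add by metis
  qed
qed

lemma tail_eventually_periodic_symbols:
  assumes "x \<in> TW" "A \<in> vecs k" "B \<in> vecs k"
    and \<pi>: "\<pi> = (\<lambda>i. int (A i) - int (B i))"
    and "tail_eventually_periodic k m \<theta> \<pi> (tcls x)"
  obtains M where "M \<in> vecs k"
    "\<And>n. n \<in> vecs k \<Longrightarrow> M \<le> n \<Longrightarrow> symbol x (A + n) = symbol x (B + n)"
proof -
  obtain T where T: "T \<in> vecs k"
      "\<And>n. n \<in> vecs k \<Longrightarrow> n \<le> T \<Longrightarrow> tail_symbol k m \<theta> (tcls x) n = tail_symbol k m \<theta> (tcls x) (n + \<pi>)"
    using assms(5) unfolding tail_eventually_periodic_def by blast
  show thesis
  proof (rule that)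
    show "(\<lambda>i. nat (- T i)) \<in> vecs k"
      using T(1) by (simp add: vecs_def)
    fix n :: "nat \<Rightarrow> nat" assume n: "n \<in> vecs k" "(\<lambda>i. nat (- T i)) \<le> n"
    let ?n = "\<lambda>i. - int ((A + n) i)"
    have sum: "?n + \<pi> = (\<lambda>i. - int ((B + n) i))"
      by (simp add: \<pi> fun_eq_iff)
    have "?n i \<le> T i" for i
    proof -
      have "nat (- T i) \<le> n i"
        using n(2) by (simp add: le_fun_def)
      then show ?thesis by simp
    qed
    then have "?n \<in> vecs k" "?n \<le> T"
      using n(1) assms(2) by (auto simp: vecs_def le_fun_def)
    then have "tail_symbol k m \<theta> (tcls x) ?n = tail_symbol k m \<theta> (tcls x) (?n + \<pi>)"
      using T(2) by blast
    then show "symbol x (A + n) = symbol x (B + n)"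
      unfolding sum using tail_symbol_tcls assms(1-3) n vecs_add by metis
  qed
qed

section \<open>Elements of a given degree\<close>

lemma list_prod_cls:
  "set ws \<subseteq> words \<Longrightarrow> list_prod S (map cls ws) = cls (concat ws)"
proof (induction ws)
  case Nil
  then show ?case by (simp add: list_prod_def semigrp_def)
next
  case (Cons w ws)
  then have "concat ws \<in> words" "w \<in> words"
    unfolding in_lists_conv_set by fastforce+
  with Cons show ?case by (simp add: list_prod_def mult_cls)
qed

lemma colored_word_in_words:
  "i \<in> {1..k} \<Longrightarrow> s \<in> lists {1..m i} \<Longrightarrow> map (Pair i) s \<in> words"
  by (auto simp: letters_def)

lemma gen_word_cls:
  assumes "i \<in> {1..k}" "s \<in> lists {1..m i}"
  shows "gen_word k m \<theta> i s = cls (map (Pair i) s)"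
proof -
  have "map (gen k m \<theta> i) s = map cls (map (\<lambda>t. [(i, t)]) s)"
    by (simp add: gen_def)
  moreover have "concat (map (\<lambda>t. [(i, t)]) s) = map (Pair i) s"
    by (induction s) auto
  moreover have "set (map (\<lambda>t. [(i, t)]) s) \<subseteq> words"
    using assms by (auto simp: letters_def)
  ultimately show ?thesis
    unfolding gen_word_def by (metis list_prod_cls)
qed

abbreviation blocks :: "(nat \<Rightarrow> nat list) \<Rightarrow> nat list \<Rightarrow> letter list" where
  "blocks u cs \<equiv> concat (map (\<lambda>i. map (Pair i) (u i)) cs)"

lemma color_count_monochromatic:
  "color_count (map (Pair i) s) = (\<lambda>j. if j = i then length s else 0)"
  by (induction s) (auto simp: color_count_def fun_eq_iff)

lemma color_count_blocks:
  assumes "distinct cs"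
  shows "color_count (blocks u cs) = (\<lambda>j. if j \<in> set cs then length (u j) else 0)"
  using assms by (induction cs) (auto simp: color_count_monochromatic fun_eq_iff)

text \<open>
  The colors are split off one after the other by unique factorization. What remains for one color is
  a word in that color alone, on which no commutation acts.
\<close>
lemma word_equiv_blocks:
  assumes "distinct cs" "set cs \<subseteq> {1..k}" "w \<in> words"
    and "color_count w = (\<lambda>j. if j \<in> set cs then c j else 0)"
  shows "\<exists>u. (\<forall>i\<in>set cs. u i \<in> lists {1..m i} \<and> length (u i) = c i) \<and> w \<approx> blocks u cs"
  using assms
proof (induction cs arbitrary: w)
  case Nil
  then have "w = []"
    by (cases w) (auto simp: color_count_def fun_eq_iff split: if_splits)
  then show ?case by (auto simp: word_rel_def)
next
  case (Cons i cs)
  let ?d = "\<lambda>j. if j = i then c i else 0" and ?d' = "\<lambda>j. if j \<in> set cs then c j else 0"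
  have "?d \<in> vecs k" "?d' \<in> vecs k" "color_count w = ?d + ?d'"
    using Cons.prems by (auto simp: vecs_def fun_eq_iff)
  from word_factor_exists[OF Cons.prems(3) this]
  obtain a b where ab: "a \<in> words" "b \<in> words" "w \<approx> a @ b" "color_count a = ?d" "color_count b = ?d'" .
  obtain s where s: "s \<in> lists {1..m i}" "length s = c i" "a = map (Pair i) s"
    using monochromatic_word ab(1,4) .
  obtain u where u: "\<forall>i\<in>set cs. u i \<in> lists {1..m i} \<and> length (u i) = c i" "b \<approx> blocks u cs"
    using Cons.IH[OF _ _ ab(2,5)] Cons.prems(1,2) by auto
  have "map (\<lambda>j. map (Pair j) ((u(i := s)) j)) cs = map (\<lambda>j. map (Pair j) (u j)) cs"
    using Cons.prems(1) by (intro map_cong) auto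
  then have "blocks (u(i := s)) (i # cs) = a @ blocks u cs"
    by (simp only: list.map concat.simps fun_upd_same s(3))
  moreover have "w \<approx> a @ blocks u cs"
    using ab u(2) by (meson word_equiv_append word_equiv_refl word_equiv_trans)
  ultimately show ?case
    using s u(1) Cons.prems(1) by (intro exI[of _ "u(i := s)"]) auto
qed

text \<open>
  The blocks are all elements of the given degree, which frees the rest of the proof from the order
  of the colors.
\<close>
lemma block_products_eq:
  assumes "1 \<le> l" "h \<le> k"
  shows "block_products k m \<theta> l h c
    = cls ` {u \<in> words. color_count u = (\<lambda>i. if i \<in> {l..h} then c i else 0)}"
proof -
  let ?cs = "[l..<Suc h]"
  have cs: "distinct ?cs" "set ?cs = {l..h}" "set ?cs \<subseteq> {1..k}"
    using assms by auto
  have *: "list_prod S (map (\<lambda>i. gen_word k m \<theta> i (u i)) ?cs) = cls (blocks u ?cs)"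
      "blocks u ?cs \<in> words"
    if u: "\<forall>i\<in>{l..h}. u i \<in> lists {1..m i} \<and> length (u i) = c i" for u
  proof -
    have "map (\<lambda>i. gen_word k m \<theta> i (u i)) ?cs = map cls (map (\<lambda>i. map (Pair i) (u i)) ?cs)"
      unfolding map_map o_def
    proof (rule map_cong[OF refl])
      fix i assume "i \<in> set ?cs"
      then show "gen_word k m \<theta> i (u i) = cls (map (Pair i) (u i))"
        using cs(2,3) u by (intro gen_word_cls) blast+
    qed
    moreover have sub: "set (map (\<lambda>i. map (Pair i) (u i)) ?cs) \<subseteq> words"
    proof
      fix w assume "w \<in> set (map (\<lambda>i. map (Pair i) (u i)) ?cs)"
      then obtain i where "i \<in> {l..h}" "w = map (Pair i) (u i)"
        using cs(2) by auto
      then show "w \<in> words"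
        using cs(2,3) u colored_word_in_words by blast
    qed
    ultimately show "list_prod S (map (\<lambda>i. gen_word k m \<theta> i (u i)) ?cs) = cls (blocks u ?cs)"
      by (metis list_prod_cls)
    show "blocks u ?cs \<in> words"
      using sub unfolding in_lists_conv_set by fastforce
  qed
  show ?thesis
  proof (intro equalityI subsetI)
    fix w assume "w \<in> block_products k m \<theta> l h c"
    then obtain u where u: "\<forall>i\<in>{l..h}. u i \<in> lists {1..m i} \<and> length (u i) = c i"
        "w = list_prod S (map (\<lambda>i. gen_word k m \<theta> i (u i)) ?cs)"
      by (auto simp: block_products_def)
    moreover have "color_count (blocks u ?cs) = (\<lambda>i. if i \<in> {l..h} then c i else 0)"
      using u(1) by (subst color_count_blocks) (auto simp: fun_eq_iff)
    ultimately show "w \<in> cls ` {u \<in> words. color_count u = (\<lambda>i. if i \<in> {l..h} then c i else 0)}"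
      using *[OF u(1)] by simp
  next
    fix w assume "w \<in> cls ` {u \<in> words. color_count u = (\<lambda>i. if i \<in> {l..h} then c i else 0)}"
    then obtain v where v: "v \<in> words" "w = cls v" "color_count v = (\<lambda>i. if i \<in> set ?cs then c i else 0)"
      unfolding cs(2) by blast
    obtain u where u: "\<forall>i\<in>{l..h}. u i \<in> lists {1..m i} \<and> length (u i) = c i" "v \<approx> blocks u ?cs"
      using word_equiv_blocks[OF cs(1,3) v(1,3)] unfolding cs(2) by blast
    have "cls v = cls (blocks u ?cs)"
      using cls_eq_iff[OF v(1) *(2)[OF u(1)]] u(2) by blast
    then have "w = list_prod S (map (\<lambda>i. gen_word k m \<theta> i (u i)) ?cs)"
      using *(1)[OF u(1)] v(2) by simp
    with u(1) show "w \<in> block_products k m \<theta> l h c"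
      unfolding block_products_def by (intro CollectI exI[of _ u] conjI)
  qed
qed

section \<open>Eventual periodicity of all tails implies periodicity\<close>

lemma iter_in_TW:
  assumes "w \<in> words" "w \<noteq> []" "\<And>i. i \<in> {1..k} \<Longrightarrow> color_count w i > 0"
  shows "w\<^sup>\<omega> \<in> TW"
proof -
  have "infinite {r. fst (w\<^sup>\<omega> r) = i}" if "i \<in> {1..k}" for i
    unfolding infinite_nat_iff_unbounded_le
  proof
    fix N
    have "i \<in> set (map fst w)"
      using assms(3)[OF that] count_list_0_iff unfolding color_count_def by (metis less_not_refl)
    then obtain j where j: "j < length w" "fst (w ! j) = i"
      by (auto simp: in_set_conv_nth)
    then have "N \<le> N * length w + j \<and> N * length w + j \<in> {r. fst (w\<^sup>\<omega> r) = i}"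
      using mod_mult_self3[of N "length w" j] by (cases "length w") simp_all
    then show "\<exists>r\<ge>N. r \<in> {r. fst (w\<^sup>\<omega> r) = i}"
      by blast
  qed
  moreover have "w\<^sup>\<omega> r \<in> letters k m" for r
    using assms(1,2) by (auto simp: in_lists_conv_set)
  ultimately show ?thesis
    by (simp add: tail_words_def)
qed

lemma tail_exists:
  assumes "k \<ge> 1"
  obtains x where "x \<in> TW"
proof
  let ?w = "map (\<lambda>i. (i, 1)) [1..<Suc k] :: letter list"
  show "?w\<^sup>\<omega> \<in> TW"
  proof (rule iter_in_TW)
    show "?w \<in> words"
      unfolding in_lists_conv_set
    proof
      fix l assume "l \<in> set ?w"
      then obtain i where i: "i \<in> {1..k}" "l = (i, 1)"
        by auto
      with gens_nonempty[OF i(1)] show "l \<in> letters k m"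
        by (simp add: letters_def)
    qed
    show "?w \<noteq> []"
      using assms by simp
    show "color_count ?w i > 0" if "i \<in> {1..k}" for i
    proof -
      have "i \<in> set (map fst ?w)"
        using that by force
      then show ?thesis
        unfolding color_count_def by (metis count_list_0_iff gr0I)
    qed
  qed
qed

text \<open>Since \<open>w\<^sup>\<omega> = w w\<^sup>\<omega>\<close>, every sum of copies of the degree of \<open>w\<close> is a period, and these are cofinal.\<close>
lemma symbol_iter_recurrent:
  assumes "w \<in> words" "w \<noteq> []" "w\<^sup>\<omega> \<in> TW" "\<And>i. i \<in> {1..k} \<Longrightarrow> color_count w i > 0" "M \<in> vecs k"
  obtains R where "R \<in> vecs k" "M \<le> R"
    "\<And>n. n \<in> vecs k \<Longrightarrow> symbol (w\<^sup>\<omega>) (R + n) = symbol (w\<^sup>\<omega>) n"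
proof -
  have eq: "w\<^sup>\<omega> \<simeq> w \<frown> w\<^sup>\<omega>"
    using assms iter_unroll[of w] tail_equiv_refl by fastforce
  have "\<exists>R\<in>vecs k. (\<forall>i\<in>{1..k}. c \<le> R i) \<and>
      (\<forall>n\<in>vecs k. symbol (w\<^sup>\<omega>) (R + n) = symbol (w\<^sup>\<omega>) n)" for c
  proof (induction c)
    case 0
    show ?case
      by (intro bexI[of _ 0]) (auto simp: vecs_def)
  next
    case (Suc c)
    then obtain R where R: "R \<in> vecs k" "\<forall>i\<in>{1..k}. c \<le> R i"
        "\<forall>n\<in>vecs k. symbol (w\<^sup>\<omega>) (R + n) = symbol (w\<^sup>\<omega>) n"
      by blast
    have "symbol (w\<^sup>\<omega>) (color_count w + R + n) = symbol (w\<^sup>\<omega>) n" if "n \<in> vecs k" for n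
      using symbol_shift[OF eq assms(1,3), of "R + n"] R(1,3) that by (metis add.assoc vecs_add)
    moreover have "Suc c \<le> (color_count w + R) i" if "i \<in> {1..k}" for i
      using assms(4)[OF that] R(2) that by fastforce
    moreover have "color_count w + R \<in> vecs k"
      using R(1) assms(1) by blast
    ultimately show ?case by blast
  qed
  from this[of "sum M {1..k}"] obtain R where R: "R \<in> vecs k" "\<forall>i\<in>{1..k}. sum M {1..k} \<le> R i"
    "\<forall>n\<in>vecs k. symbol (w\<^sup>\<omega>) (R + n) = symbol (w\<^sup>\<omega>) n"
    by blast
  then have "M \<le> R"
    using vecs_le_of_sum_le assms(5) by blast
  with R that show thesis by blast
qed

lemma symbol_cong:
  assumes "init x n = init y n" "\<And>i. i \<in> {1..k} \<Longrightarrow> init x (n + unit_vec i) = init y (n + unit_vec i)"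
  shows "symbol x n = symbol y n"
  unfolding symbol_def using assms by (intro restrict_ext) simp

text \<open>
  The symbols of \<open>x\<close> at \<open>A + n\<close> and \<open>B + n\<close> are those of \<open>u\<^sup>\<omega>\<close> for a sufficiently long initial
  segment \<open>u\<close> of \<open>x\<close>. In \<open>u\<^sup>\<omega>\<close> both positions can be moved by a period \<open>R\<close> into the range where the
  eventual periodicity of \<open>u\<^sup>\<omega>\<close> applies.
\<close>
lemma eventually_periodic_imp_periodic:
  assumes "k \<ge> 1" "A \<in> vecs k" "B \<in> vecs k"
    and ev: "\<And>x. x \<in> TW \<Longrightarrow>
      \<exists>M\<in>vecs k. \<forall>n\<in>vecs k. M \<le> n \<longrightarrow> symbol x (A + n) = symbol x (B + n)"
    and "x \<in> TW" "n \<in> vecs k"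
  shows "symbol x (A + n) = symbol x (B + n)"
proof -
  \<comment> \<open>The symbols at \<open>n'\<close> read initial segments of degree \<open>n' + \<epsilon>\<^sub>i\<close>. The summand \<open>?one\<close> covers these
    and also makes every color occur in \<open>u\<close>, so that \<open>u\<^sup>\<omega>\<close> is a tail.\<close>
  let ?one = "\<lambda>i. if i \<in> {1..k} then 1 else 0 :: nat"
  define D where "D = A + B + n + ?one"
  have D: "D \<in> vecs k"
    using assms by (auto simp: D_def vecs_def)
  obtain N u v where u: "u \<in> words" "v \<in> words" "prefix N x \<approx> u @ v" "color_count u = D" "init x D = cls u"
    using word_initE assms(5) D .
  have pos: "color_count u i > 0" if "i \<in> {1..k}" for i
    using that by (simp add: u(4) D_def)
  have ne: "u \<noteq> []"
    using pos[of 1] assms(1) by (auto simp: color_count_def)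
  let ?t = "u\<^sup>\<omega>"
  have t: "?t \<in> TW"
    using iter_in_TW u(1) ne pos .
  have "prefix (length u) ?t = u"
    using iter_unroll[of u] ne by (metis length_greater_0_conv prefix_conc_length)
  then have "init ?t D = cls u"
    using word_init_eqI[OF t u(1), of "[]" "length u"] u by auto
  then have agree: "init x n' = init ?t n'" if "n' \<le> D" for n'
    using init_eq_mono[OF assms(5) t D that] u(5) by simp
  have sym: "symbol x n' = symbol ?t n'" if "n' + ?one \<le> D" for n'
  proof (rule symbol_cong)
    have le: "n' i + ?one i \<le> D i" for i
      using le_funD[OF that, of i] by simp
    show "init x n' = init ?t n'"
      by (rule agree, rule le_funI) (use le add_leD1 in blast)
    show "init x (n' + unit_vec i) = init ?t (n' + unit_vec i)" if "i \<in> {1..k}" for i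
    proof (rule agree, rule le_funI)
      fix j show "(n' + unit_vec i) j \<le> D j"
        using le[of j] that by (auto simp: unit_vec_def split: if_splits)
    qed
  qed
  obtain M where M: "M \<in> vecs k" "\<And>n. n \<in> vecs k \<Longrightarrow> M \<le> n \<Longrightarrow> symbol ?t (A + n) = symbol ?t (B + n)"
    using ev[OF t] by blast
  from symbol_iter_recurrent[OF u(1) ne t pos M(1)]
  obtain R where R: "R \<in> vecs k" "M \<le> R" "\<And>n. n \<in> vecs k \<Longrightarrow> symbol ?t (R + n) = symbol ?t n"
    by metis
  have "M \<le> R + n"
    using R(2) by (auto simp: le_fun_def intro: trans_le_add1)
  then have eq: "symbol ?t (A + (R + n)) = symbol ?t (B + (R + n))"
    using M R(1) assms(6) by blast
  have "symbol x (A + n) = symbol ?t (A + n)"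
    by (rule sym) (auto simp: D_def le_fun_def)
  also have "\<dots> = symbol ?t (A + (R + n))"
    using R(3)[of "A + n"] assms by (metis add.left_commute vecs_add)
  also have "\<dots> = symbol ?t (B + n)"
    unfolding eq using R(3)[of "B + n"] assms by (metis add.left_commute vecs_add)
  also have "\<dots> = symbol x (B + n)"
    by (rule sym[symmetric]) (auto simp: D_def le_fun_def)
  finally show ?thesis .
qed

section \<open>Periodicity and the bijection\<close>

lemma prefix_tail_cls:
  assumes "u \<in> words" "x \<in> TW"
  shows "prefix_tail k m \<theta> (cls u) (tcls x) = tcls (u \<frown> x)"
proof -
  have "tcls (u' \<frown> x') = tcls (u \<frown> x)" if "u' \<in> cls u" "x' \<in> tcls x" for u' x'
    using that conc_cong[of u u' x x'] equiv_class_eq[OF equiv_tail_rel]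
    by (auto simp: word_class_def)
  moreover have "u \<in> cls u" "x \<in> tcls x"
    using assms by (auto simp: word_class_def)
  ultimately show ?thesis
    unfolding prefix_tail_def by blast
qed

lemma tcls_eq_iff: "x \<in> TW \<Longrightarrow> y \<in> TW \<Longrightarrow> tcls x = tcls y \<longleftrightarrow> x \<simeq> y"
  by (rule eq_equiv_class_iff[OF equiv_tail_rel])

lemma prefix_tail_eq_iff:
  assumes "u \<in> words" "v \<in> words"
  shows "(\<forall>\<tau>\<in>tails k m \<theta>. prefix_tail k m \<theta> (cls u) \<tau> = prefix_tail k m \<theta> (cls v) \<tau>)
    \<longleftrightarrow> (\<forall>x\<in>TW. u \<frown> x \<simeq> v \<frown> x)"
proof -
  have "prefix_tail k m \<theta> (cls u) (tcls x) = prefix_tail k m \<theta> (cls v) (tcls x) \<longleftrightarrow> u \<frown> x \<simeq> v \<frown> x"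
    if "x \<in> TW" for x
    using prefix_tail_cls[OF assms(1) that] prefix_tail_cls[OF assms(2) that]
      tcls_eq_iff[OF conc_in_TW[OF assms(1) that] conc_in_TW[OF assms(2) that]] by simp
  moreover have "tails k m \<theta> = tcls ` TW"
    using tails_iff by blast
  ultimately show ?thesis
    by simp
qed

text \<open>
  The symbols of the remainders \<open>y\<close> and \<open>z\<close> at \<open>n\<close> are those of \<open>x\<close> at \<open>deg u + n\<close> and \<open>deg v + n\<close>, and
  symbols determine a tail.
\<close>
lemma periodic_shifts_equiv:
  assumes "\<And>n. n \<in> vecs k \<Longrightarrow> symbol x (color_count u + n) = symbol x (color_count v + n)"
    and "x \<simeq> u \<frown> y" "x \<simeq> v \<frown> z" "u \<in> words" "v \<in> words" "y \<in> TW" "z \<in> TW"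
  shows "y \<simeq> z"
  using assms symbol_shift by (intro symbols_determine_tail) metis+

definition words_of :: "(nat \<Rightarrow> nat) \<Rightarrow> letter list set" where
  "words_of d = {u \<in> words. color_count u = d}"

definition interchangeable :: "letter list \<Rightarrow> letter list \<Rightarrow> bool" where
  "interchangeable u v \<longleftrightarrow> (\<forall>x\<in>TW. u \<frown> x \<simeq> v \<frown> x)"

lemma words_ofD:
  assumes "u \<in> words_of d"
  shows "u \<in> words" "color_count u = d"
  using assms by (auto simp: words_of_def)

lemma words_of_nonempty:
  assumes "k \<ge> 1" "d \<in> vecs k"
  obtains u where "u \<in> words_of d"
proof -
  obtain x where "x \<in> TW"
    using tail_exists assms(1) .
  then obtain u y where "u \<in> words" "color_count u = d"
    using tail_split assms(2) by metis
  then show thesis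
    using that by (simp add: words_of_def)
qed

lemma words_of_split:
  assumes "w \<in> words_of (d + d')" "d \<in> vecs k" "d' \<in> vecs k"
  obtains u v where "u \<in> words_of d" "v \<in> words_of d'" "w \<approx> u @ v"
proof -
  have "w \<in> words" "color_count w = d + d'"
    using words_ofD[OF assms(1)] .
  from word_factor_exists[OF this(1) assms(2,3) this(2)]
  obtain u v where "u \<in> words" "v \<in> words" "w \<approx> u @ v" "color_count u = d" "color_count v = d'" .
  with that show thesis
    by (simp add: words_of_def)
qed

lemma words_of_append: "u \<in> words_of d \<Longrightarrow> v \<in> words_of d' \<Longrightarrow> u @ v \<in> words_of (d + d')"
  by (auto simp: words_of_def)

lemma interchangeable_sym: "interchangeable u v \<Longrightarrow> interchangeable v u"
  unfolding interchangeable_def using tail_equiv_sym by blast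

text \<open>One tail is enough to recover a partner, as its initial segment of degree \<open>d\<close>.\<close>
lemma interchangeable_unique:
  assumes "k \<ge> 1" "interchangeable u v" "interchangeable u v'" "v \<in> words_of d" "v' \<in> words_of d"
  shows "v \<approx> v'"
proof -
  obtain x where x: "x \<in> TW" using tail_exists[OF assms(1)] .
  then have "v \<frown> x \<simeq> v' \<frown> x"
    using assms(2,3) unfolding interchangeable_def by (meson tail_equiv_sym tail_equiv_trans)
  then show ?thesis
    using conc_cancel(1) assms(4,5) x by (auto simp: words_of_def)
qed

lemma interchangeable_cong:
  assumes "u \<approx> u'" "v \<approx> v'" "interchangeable u v"
  shows "interchangeable u' v'"
  unfolding interchangeable_def
proof
  fix x assume x: "x \<in> TW"
  have "u' \<frown> x \<simeq> u \<frown> x"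
    using conc_cong word_equiv_sym[OF assms(1)] tail_equiv_refl[OF x] .
  also have "u \<frown> x \<simeq> v \<frown> x"
    using assms(3) x by (simp add: interchangeable_def)
  also have "v \<frown> x \<simeq> v' \<frown> x"
    using conc_cong assms(2) tail_equiv_refl[OF x] .
  finally show "u' \<frown> x \<simeq> v' \<frown> x" .
qed

text \<open>
  The tail \<open>uvx = v'u'x\<close> has \<open>vx\<close> as the remainder after degree \<open>A\<close> and \<open>u'x\<close> as the remainder after
  degree \<open>B\<close>. The factorization does not mention \<open>x\<close>, so the conclusion is uniform in \<open>x\<close>.
\<close>
lemma periodic_interchangeable:
  assumes per: "\<And>x n. x \<in> TW \<Longrightarrow> n \<in> vecs k \<Longrightarrow> symbol x (A + n) = symbol x (B + n)"
    and "u \<in> words_of A" "v \<in> words_of B" "u' \<in> words_of A" "v' \<in> words_of B"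
    and "u @ v \<approx> v' @ u'"
  shows "interchangeable u' v"
  unfolding interchangeable_def
proof
  fix x assume x: "x \<in> TW"
  let ?z = "u \<frown> (v \<frown> x)"
  note w = words_ofD[OF assms(2)] words_ofD[OF assms(3)] words_ofD[OF assms(4)] words_ofD[OF assms(5)]
  have z: "?z \<in> TW"
    using conc_in_TW w x by blast
  have "?z \<simeq> v' \<frown> (u' \<frown> x)"
    using conc_cong[OF assms(6) tail_equiv_refl[OF x]] by simp
  moreover have "symbol ?z (color_count v' + n) = symbol ?z (color_count u + n)" if "n \<in> vecs k" for n
    using per[OF z that] w by simp
  ultimately show "u' \<frown> x \<simeq> v \<frown> x"
    using periodic_shifts_equiv[of ?z v' u "u' \<frown> x" "v \<frown> x"] z w x conc_in_TW by blast
qed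

text \<open>
  Any word of degree \<open>A\<close> may be put in front of \<open>v\<close>; the partner is read off from the refactored
  product. The roles of \<open>A\<close> and \<open>B\<close> can be exchanged, which gives partners in both directions.
\<close>
lemma periodic_partner:
  assumes "k \<ge> 1" "A \<in> vecs k" "B \<in> vecs k"
    and per: "\<And>x n. x \<in> TW \<Longrightarrow> n \<in> vecs k \<Longrightarrow> symbol x (A + n) = symbol x (B + n)"
    and "v \<in> words_of B"
  obtains u where "u \<in> words_of A" "interchangeable u v"
proof -
  obtain u0 where u0: "u0 \<in> words_of A"
    using words_of_nonempty assms(1,2) .
  have "u0 @ v \<in> words_of (B + A)"
    using words_of_append[OF u0 assms(5)] by (simp add: add.commute)
  then obtain v' u' where *: "v' \<in> words_of B" "u' \<in> words_of A" "u0 @ v \<approx> v' @ u'"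
    using words_of_split assms(2,3) by blast
  then have "interchangeable u' v"
    using periodic_interchangeable per u0 assms(5) by blast
  with that *(2) show thesis .
qed

text \<open>
  The map \<open>\<gamma>\<close> sends an element to the class of its partner. For the exchange identity, refactor
  \<open>uv = v'u'\<close>. Then \<open>u'\<close> is the partner of \<open>v\<close>. If \<open>v''\<close> is the partner of \<open>u\<close>, then
  \<open>v'u'x = uvx = v''vx\<close> for a tail \<open>x\<close>, and comparing initial segments of degree \<open>B\<close> gives \<open>v' = v''\<close>.
\<close>
lemma periodic_imp_bijection:
  assumes "k \<ge> 1" "A \<in> vecs k" "B \<in> vecs k"
    and per: "\<And>x n. x \<in> TW \<Longrightarrow> n \<in> vecs k \<Longrightarrow> symbol x (A + n) = symbol x (B + n)"
  obtains \<gamma> where "bij_betw \<gamma> (cls ` words_of A) (cls ` words_of B)"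
    "\<And>e f. e \<in> cls ` words_of A \<Longrightarrow> f \<in> cls ` words_of B \<Longrightarrow>
      e \<otimes>\<^bsub>S\<^esub> f = \<gamma> e \<otimes>\<^bsub>S\<^esub> inv_into (cls ` words_of A) \<gamma> f"
    "\<And>u v. u \<in> words_of A \<Longrightarrow> v \<in> words_of B \<Longrightarrow> \<gamma> (cls u) = cls v \<Longrightarrow> interchangeable u v"
proof -
  let ?E = "cls ` words_of A" and ?F = "cls ` words_of B"
  have cls_eq: "cls u = cls v \<longleftrightarrow> u \<approx> v" if "u \<in> words_of d" "v \<in> words_of d'" for u v d d'
    using that by (intro cls_eq_iff words_ofD)
  define \<gamma> where "\<gamma> e = (THE f. \<exists>u\<in>words_of A. \<exists>v\<in>words_of B. e = cls u \<and> f = cls v \<and> interchangeable u v)" for e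
  have \<gamma>_eq: "\<gamma> (cls u) = cls v" if uv: "u \<in> words_of A" "v \<in> words_of B" "interchangeable u v" for u v
    unfolding \<gamma>_def
  proof (rule the_equality)
    fix f assume "\<exists>u'\<in>words_of A. \<exists>v\<in>words_of B. cls u = cls u' \<and> f = cls v \<and> interchangeable u' v"
    then obtain u' v' where *: "u' \<in> words_of A" "v' \<in> words_of B" "u' \<approx> u" "f = cls v'" "interchangeable u' v'"
      using cls_eq uv(1) word_equiv_sym by metis
    have "interchangeable u v'"
      using interchangeable_cong[OF *(3) _ *(5)] words_ofD(1)[OF *(2)] by blast
    then have "v' \<approx> v"
      using interchangeable_unique assms(1) uv *(2) by blast
    then show "f = cls v"
      using cls_eq *(2,4) uv(2) by blast
  qed (use uv in blast)
  have partner: "\<exists>v\<in>words_of B. interchangeable u v" if "u \<in> words_of A" for u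
    using periodic_partner[OF assms(1,3,2) per[symmetric] that] interchangeable_sym by metis
  have partner': "\<exists>u\<in>words_of A. interchangeable u v" if "v \<in> words_of B" for v
    using periodic_partner[OF assms(1,2,3) per that] by metis
  have inter: "interchangeable u v" if uv: "u \<in> words_of A" "v \<in> words_of B" "\<gamma> (cls u) = cls v" for u v
  proof -
    obtain v' where v': "v' \<in> words_of B" "interchangeable u v'"
      using partner uv(1) by blast
    then have "v' \<approx> v"
      using \<gamma>_eq uv cls_eq by metis
    then show ?thesis
      using interchangeable_cong v'(2) words_ofD(1)[OF uv(1)] by blast
  qed
  have inj: "inj_on \<gamma> ?E"
  proof (rule inj_onI)
    fix e e' assume "e \<in> ?E" "e' \<in> ?E" and eq: "\<gamma> e = \<gamma> e'"
    then obtain u u' where u: "u \<in> words_of A" "e = cls u" "u' \<in> words_of A" "e' = cls u'"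
      by blast
    obtain v where v: "v \<in> words_of B" "interchangeable u v"
      using partner u(1) by blast
    then have "\<gamma> (cls u') = cls v"
      using \<gamma>_eq u eq by metis
    then have "interchangeable u' v"
      using inter u(3) v(1) by blast
    then have "u \<approx> u'"
      using interchangeable_unique[OF assms(1)] v(2) u interchangeable_sym by metis
    then show "e = e'"
      using cls_eq u by blast
  qed
  have "\<gamma> ` ?E = ?F"
  proof (intro equalityI subsetI)
    fix f assume "f \<in> \<gamma> ` ?E"
    then obtain u where u: "u \<in> words_of A" "f = \<gamma> (cls u)"
      by blast
    obtain v where "v \<in> words_of B" "interchangeable u v"
      using partner u(1) by blast
    then have "f = cls v"
      using \<gamma>_eq u by simp
    with \<open>v \<in> words_of B\<close> show "f \<in> ?F" by blast
  next
    fix f assume "f \<in> ?F"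
    then obtain v where v: "v \<in> words_of B" "f = cls v"
      by blast
    obtain u where "u \<in> words_of A" "interchangeable u v"
      using partner' v(1) by blast
    then have "f = \<gamma> (cls u)"
      using \<gamma>_eq v by simp
    with \<open>u \<in> words_of A\<close> show "f \<in> \<gamma> ` ?E" by blast
  qed
  with inj have bij: "bij_betw \<gamma> ?E ?F"
    by (simp add: bij_betw_def)
  moreover have "e \<otimes>\<^bsub>S\<^esub> f = \<gamma> e \<otimes>\<^bsub>S\<^esub> inv_into ?E \<gamma> f" if ef: "e \<in> ?E" "f \<in> ?F" for e f
  proof -
    obtain u v where uv: "u \<in> words_of A" "e = cls u" "v \<in> words_of B" "f = cls v"
      using ef by blast
    have "u @ v \<in> words_of (B + A)"
      using words_of_append[OF uv(1,3)] by (simp add: add.commute)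
    from words_of_split[OF this assms(3,2)]
    obtain v' u' where vu: "v' \<in> words_of B" "u' \<in> words_of A" "u @ v \<approx> v' @ u'" .
    have "interchangeable u' v"
      using periodic_interchangeable[OF per uv(1,3) vu(2,1,3)] .
    then have "\<gamma> (cls u') = f"
      using \<gamma>_eq vu(2) uv(3,4) by simp
    then have inv: "inv_into ?E \<gamma> f = cls u'"
      using inv_into_f_f[OF inj imageI[OF vu(2)]] by simp
    obtain v'' where v'': "v'' \<in> words_of B" "interchangeable u v''"
      using partner uv(1) by blast
    obtain x where x: "x \<in> TW"
      using tail_exists[OF assms(1)] .
    have vx: "v \<frown> x \<in> TW" "u' \<frown> x \<in> TW"
      using conc_in_TW words_ofD(1) uv(3) vu(2) x by blast+
    have "v' \<frown> (u' \<frown> x) \<simeq> u \<frown> (v \<frown> x)"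
      using conc_cong[OF vu(3) tail_equiv_refl[OF x]] tail_equiv_sym by simp
    also have "u \<frown> (v \<frown> x) \<simeq> v'' \<frown> (v \<frown> x)"
      using v''(2) vx(1) by (simp only: interchangeable_def)
    finally have "v' \<approx> v''"
      using conc_cancel(1) words_ofD[OF vu(1)] words_ofD[OF v''(1)] vx by metis
    then have "\<gamma> e = cls v'"
      using \<gamma>_eq uv(1,2) v'' cls_eq vu(1) by metis
    moreover have "cls u \<otimes>\<^bsub>S\<^esub> cls v = cls v' \<otimes>\<^bsub>S\<^esub> cls u'"
    proof -
      have "cls (u @ v) = cls (v' @ u')"
        using vu(3) cls_eq_iff word_equivD(1,2) by metis
      then show ?thesis
        using words_ofD(1) uv(1,3) vu(1,2) by (simp add: mult_cls)
    qed
    ultimately show ?thesis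
      using inv uv(2,4) by simp
  qed
  ultimately show thesis
    using that inter by blast
qed

lemma interchangeable_imp_periodic:
  assumes "A \<in> vecs k" "\<And>u. u \<in> words_of A \<Longrightarrow> \<exists>v\<in>words_of B. interchangeable u v"
    and "x \<in> TW" "n \<in> vecs k"
  shows "symbol x (A + n) = symbol x (B + n)"
proof -
  obtain u y where u: "u \<in> words" "y \<in> TW" "color_count u = A" "x \<simeq> u \<frown> y"
    using tail_split assms(3,1) .
  then obtain v where v: "v \<in> words_of B" "interchangeable u v"
    using assms(2) unfolding words_of_def by blast
  then have "x \<simeq> v \<frown> y"
    using u(2,4) unfolding interchangeable_def by (meson tail_equiv_trans)
  then show ?thesis
    using symbol_shift[OF u(4,1,2) assms(4)] symbol_shift[of x v y n] words_ofD[OF v(1)] u assms(4)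
    by simp
qed

text \<open>
  Write \<open>x = v\<^sub>1 u\<^sub>1 y\<close> with \<open>v\<^sub>1\<close> of degree \<open>B\<close> and \<open>u\<^sub>1\<close> of degree \<open>A\<close>, let \<open>u\<^sub>2 = \<gamma>\<^sup>-\<^sup>1(v\<^sub>1)\<close>,
  \<open>v\<^sub>3 = \<gamma>(u\<^sub>1)\<close> and \<open>v = \<gamma>(u)\<close>. The exchange identity gives \<open>u v\<^sub>1 = v u\<^sub>2\<close> and \<open>v\<^sub>1 u\<^sub>1 = u\<^sub>2 v\<^sub>3\<close>, so
  \<open>ux = (v u\<^sub>2) u\<^sub>1 y\<close> and \<open>vx = (v u\<^sub>2) v\<^sub>3 y\<close>. The question for \<open>(u, v, x)\<close> thus becomes the same
  question for \<open>(u\<^sub>1, v\<^sub>3, y)\<close> behind a common word of degree \<open>A + B\<close>.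
\<close>
lemma exchange_imp_interchangeable:
  assumes A: "A \<in> vecs k" and B: "B \<in> vecs k"
    and full: "\<And>i. i \<in> {1..k} \<Longrightarrow> A i + B i > 0"
    and bij: "bij_betw \<gamma> (cls ` words_of A) (cls ` words_of B)"
    and ex: "\<And>e f. e \<in> cls ` words_of A \<Longrightarrow> f \<in> cls ` words_of B \<Longrightarrow>
      e \<otimes>\<^bsub>S\<^esub> f = \<gamma> e \<otimes>\<^bsub>S\<^esub> inv_into (cls ` words_of A) \<gamma> f"
    and "u \<in> words_of A" "v \<in> words_of B" "\<gamma> (cls u) = cls v"
  shows "interchangeable u v"
proof -
  let ?E = "cls ` words_of A" and ?F = "cls ` words_of B"
  have swap: "u @ v' \<approx> v @ u'"
    if "u \<in> words_of A" "v \<in> words_of B" "u' \<in> words_of A" "v' \<in> words_of B"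
      "\<gamma> (cls u) = cls v" "\<gamma> (cls u') = cls v'" for u v u' v'
  proof -
    have "inv_into ?E \<gamma> (cls v') = cls u'"
      using inv_into_f_f[OF bij_betw_imp_inj_on[OF bij] imageI[OF that(3)]] that(6) by simp
    then have "cls (u @ v') = cls (v @ u')"
      using ex[of "cls u" "cls v'"] that mult_cls words_ofD(1) by (metis imageI)
    then show ?thesis
      using that words_ofD(1) by (simp add: cls_eq_iff)
  qed
  have "\<exists>N\<in>vecs k. (\<forall>i\<in>{1..k}. c \<le> N i) \<and>
      (\<forall>u\<in>words_of A. \<forall>v\<in>words_of B. \<gamma> (cls u) = cls v \<longrightarrow>
        (\<forall>x\<in>TW. init (u \<frown> x) N = init (v \<frown> x) N))" for c
  proof (induction c)
    case 0
    have "init (u \<frown> x) 0 = init (v \<frown> x) 0"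
      if "u \<in> words_of A" "v \<in> words_of B" "x \<in> TW" for u v x
      using that init_zero conc_in_TW words_ofD(1) by metis
    moreover have "0 \<in> vecs k"
      by (simp add: vecs_def)
    ultimately show ?case by blast
  next
    case (Suc c)
    then obtain N where N: "N \<in> vecs k" "\<forall>i\<in>{1..k}. c \<le> N i"
      and IH: "\<forall>u\<in>words_of A. \<forall>v\<in>words_of B. \<gamma> (cls u) = cls v \<longrightarrow>
        (\<forall>x\<in>TW. init (u \<frown> x) N = init (v \<frown> x) N)"
      by (elim bexE conjE)
    let ?N = "A + B + N"
    have "init (u \<frown> x) ?N = init (v \<frown> x) ?N"
      if uv: "u \<in> words_of A" "v \<in> words_of B" "\<gamma> (cls u) = cls v" and x: "x \<in> TW" for u v x
    proof -
      obtain v1 y where v1: "v1 \<in> words" "y \<in> TW" "color_count v1 = B" "x \<simeq> v1 \<frown> y"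
        using tail_split x B .
      obtain u1 x1 where u1: "u1 \<in> words" "x1 \<in> TW" "color_count u1 = A" "y \<simeq> u1 \<frown> x1"
        using tail_split v1(2) A .
      have of: "v1 \<in> words_of B" "u1 \<in> words_of A"
        using v1 u1 by (auto simp: words_of_def)
      have "cls v1 \<in> \<gamma> ` ?E" "\<gamma> (cls u1) \<in> ?F"
        using of bij bij_betw_imp_surj_on[OF bij] by auto
      then obtain u2 v3 where u2: "u2 \<in> words_of A" "\<gamma> (cls u2) = cls v1"
        and v3: "v3 \<in> words_of B" "\<gamma> (cls u1) = cls v3"
        by (elim imageE) metis
      note w = words_ofD[OF uv(1)] words_ofD[OF uv(2)] words_ofD[OF u2(1)] words_ofD[OF v3(1)]
      have x_split: "x \<simeq> (v1 @ u1) \<frown> x1"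
        using v1(4) conc_cong[OF word_equiv_refl[OF v1(1)] u1(4)] tail_equiv_trans by simp
      have tw: "u1 \<frown> x1 \<in> TW" "v3 \<frown> x1 \<in> TW" "u \<frown> x \<in> TW" "v \<frown> x \<in> TW"
        using conc_in_TW u1 w x by blast+
      have vu2: "v @ u2 \<in> words" "color_count (v @ u2) + N = ?N"
        using w by (auto simp: add.commute)
      have "u \<frown> x \<simeq> u \<frown> ((v1 @ u1) \<frown> x1)"
        using conc_cong[OF word_equiv_refl[OF w(1)] x_split] .
      also have "u \<frown> ((v1 @ u1) \<frown> x1) = (u @ v1) \<frown> (u1 \<frown> x1)"
        by simp
      also have "(u @ v1) \<frown> (u1 \<frown> x1) \<simeq> (v @ u2) \<frown> (u1 \<frown> x1)"
        using conc_cong[OF swap[OF uv(1,2) u2(1) of(1) uv(3) u2(2)] tail_equiv_refl[OF tw(1)]] .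
      finally have 1: "u \<frown> x \<simeq> (v @ u2) \<frown> (u1 \<frown> x1)" .
      have "v \<frown> x \<simeq> v \<frown> ((v1 @ u1) \<frown> x1)"
        using conc_cong[OF word_equiv_refl[OF w(3)] x_split] .
      also have "v \<frown> ((v1 @ u1) \<frown> x1) \<simeq> v \<frown> ((u2 @ v3) \<frown> x1)"
        using word_equiv_sym[OF swap[OF u2(1) of(1) of(2) v3(1) u2(2) v3(2)]]
        by (intro conc_cong word_equiv_refl w tail_equiv_refl u1)
      also have "v \<frown> ((u2 @ v3) \<frown> x1) = (v @ u2) \<frown> (v3 \<frown> x1)"
        by simp
      finally have 2: "v \<frown> x \<simeq> (v @ u2) \<frown> (v3 \<frown> x1)" .
      have N': "?N \<in> vecs k"
        using A B N(1) by blast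
      have "init (u \<frown> x) ?N = cls (v @ u2) \<otimes>\<^bsub>S\<^esub> init (u1 \<frown> x1) N"
        using tail_equivD(3)[OF 1 N'] init_conc[OF vu2(1) tw(1) N(1)] vu2(2) by metis
      also have "init (u1 \<frown> x1) N = init (v3 \<frown> x1) N"
        using IH of(2) v3 u1(2) by simp
      also have "cls (v @ u2) \<otimes>\<^bsub>S\<^esub> init (v3 \<frown> x1) N = init (v \<frown> x) ?N"
        using tail_equivD(3)[OF 2 N'] init_conc[OF vu2(1) tw(2) N(1)] vu2(2) by metis
      finally show ?thesis .
    qed
    moreover have "Suc c \<le> ?N i" if "i \<in> {1..k}" for i
    proof -
      have "c \<le> N i" "A i + B i > 0"
        using N(2) full that by auto
      then show ?thesis by auto
    qed
    moreover have "?N \<in> vecs k"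
      using A B N(1) by blast
    ultimately show ?case by blast
  qed note agree = this
  show ?thesis
    unfolding interchangeable_def
  proof
    fix x assume x: "x \<in> TW"
    show "u \<frown> x \<simeq> v \<frown> x"
    proof (rule tail_equivI)
      show "u \<frown> x \<in> TW" "v \<frown> x \<in> TW"
        using conc_in_TW words_ofD(1) assms(6,7) x by blast+
      fix n :: "nat \<Rightarrow> nat" assume n: "n \<in> vecs k"
      from agree[of "sum n {1..k}"]
      obtain N where N: "N \<in> vecs k" "\<forall>i\<in>{1..k}. sum n {1..k} \<le> N i"
        and all: "\<forall>u\<in>words_of A. \<forall>v\<in>words_of B. \<gamma> (cls u) = cls v \<longrightarrow>
          (\<forall>x\<in>TW. init (u \<frown> x) N = init (v \<frown> x) N)"
        by (elim bexE conjE)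
      have "init (u \<frown> x) N = init (v \<frown> x) N"
        using all assms(6-8) x by simp
      moreover      have "n \<le> N"
        using n N(2) vecs_le_of_sum_le by blast
      ultimately show "\<exists>n'\<in>vecs k. n \<le> n' \<and> init (u \<frown> x) n' = init (v \<frown> x) n'"
        using N(1) by blast
    qed
  qed
qed

end

theorem theorem7p1:
  fixes k p q :: nat and m a b :: "nat \<Rightarrow> nat" and \<theta> :: perms
    and \<pi> :: "nat \<Rightarrow> int" and E F :: "letter list set set"
  assumes "single_vertex_kgraph k m \<theta>"
    and "p \<ge> 1" and "q \<ge> 1" and "p + q \<le> k"
    and "\<And>i. i \<in> {1..p} \<Longrightarrow> a i > 0"
    and "\<And>j. j \<in> {p+1..p+q} \<Longrightarrow> b j > 0"
    and pi_def: "\<pi> = (\<lambda>i. if i \<in> {1..p} then int (a i)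
                          else if i \<in> {p+1..p+q} then - int (b i) else 0)"
    and E_def: "E = block_products k m \<theta> 1 p a"
    and F_def: "F = block_products k m \<theta> (p+1) (p+q) b"
  shows
    "(kgraph_periodic k m \<theta> \<pi> \<longleftrightarrow> (\<forall>\<tau>\<in>tails k m \<theta>. tail_periodic k m \<theta> \<pi> \<tau>)) \<and>
     ((\<forall>\<tau>\<in>tails k m \<theta>. tail_periodic k m \<theta> \<pi> \<tau>) \<longleftrightarrow>
       (\<exists>\<gamma>. bij_betw \<gamma> E F \<and>
          (\<forall>e\<in>E. \<forall>f\<in>F. e \<otimes>\<^bsub>semigrp k m \<theta>\<^esub> f = \<gamma> e \<otimes>\<^bsub>semigrp k m \<theta>\<^esub> inv_into E \<gamma> f) \<and>
          (\<forall>\<tau>\<in>tails k m \<theta>. \<forall>e\<in>E. prefix_tail k m \<theta> e \<tau> = prefix_tail k m \<theta> (\<gamma> e) \<tau>))) \<and>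
     (p + q = k \<longrightarrow>
       (\<forall>\<gamma>. bij_betw \<gamma> E F \<and>
          (\<forall>e\<in>E. \<forall>f\<in>F. e \<otimes>\<^bsub>semigrp k m \<theta>\<^esub> f = \<gamma> e \<otimes>\<^bsub>semigrp k m \<theta>\<^esub> inv_into E \<gamma> f) \<longrightarrow>
          (\<forall>\<tau>\<in>tails k m \<theta>. \<forall>e\<in>E. prefix_tail k m \<theta> e \<tau> = prefix_tail k m \<theta> (\<gamma> e) \<tau>)))"
proof -
  interpret single_vertex_kgraph k m \<theta> by fact
  define A where "A = (\<lambda>i. if i \<in> {1..p} then a i else 0)"
  define B where "B = (\<lambda>i. if i \<in> {p+1..p+q} then b i else 0)"
  have k: "k \<ge> 1" and A: "A \<in> vecs k" and B: "B \<in> vecs k"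
    using assms(2-4) by (auto simp: A_def B_def vecs_def)
  have \<pi>: "\<pi> = (\<lambda>i. int (A i) - int (B i))" and disj: "A i = 0 \<or> B i = 0" for i
    by (auto simp: pi_def A_def B_def fun_eq_iff)
  have E: "E = cls ` words_of A" and F: "F = cls ` words_of B"
    using assms(4) block_products_eq[of 1 p a] block_products_eq[of "p + 1" "p + q" b]
    unfolding E_def F_def A_def B_def words_of_def by simp_all
  let ?exchange = "\<lambda>\<gamma>. bij_betw \<gamma> E F \<and>
    (\<forall>e\<in>E. \<forall>f\<in>F. e \<otimes>\<^bsub>S\<^esub> f = \<gamma> e \<otimes>\<^bsub>S\<^esub> inv_into E \<gamma> f)"
  let ?same_tails = "\<lambda>\<gamma>. \<forall>\<tau>\<in>tails k m \<theta>. \<forall>e\<in>E. prefix_tail k m \<theta> e \<tau> = prefix_tail k m \<theta> (\<gamma> e) \<tau>"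
  have tails_eq: "tails k m \<theta> = tcls ` TW"
    using tails_iff by blast
  have periodic: "(\<forall>\<tau>\<in>tails k m \<theta>. tail_periodic k m \<theta> \<pi> \<tau>) \<longleftrightarrow>
      (\<forall>x\<in>TW. \<forall>n\<in>vecs k. symbol x (A + n) = symbol x (B + n))"
    using tail_periodic_iff[OF _ A B disj \<pi>] unfolding tails_eq by simp
  have same_tails: "?same_tails \<gamma> \<longleftrightarrow>
      (\<forall>u\<in>words_of A. \<forall>v\<in>words_of B. \<gamma> (cls u) = cls v \<longrightarrow> interchangeable u v)"
    if bij: "bij_betw \<gamma> E F" for \<gamma>
  proof -
    let ?same = "\<lambda>e f. \<forall>\<tau>\<in>tails k m \<theta>. prefix_tail k m \<theta> e \<tau> = prefix_tail k m \<theta> f \<tau>"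
    have iff: "?same (cls u) (cls v) \<longleftrightarrow> interchangeable u v"
      if "u \<in> words_of A" "v \<in> words_of B" for u v
      unfolding interchangeable_def using that by (intro prefix_tail_eq_iff words_ofD(1))
    have "?same_tails \<gamma> \<longleftrightarrow> (\<forall>u\<in>words_of A. ?same (cls u) (\<gamma> (cls u)))"
      unfolding E by blast
    also have "\<dots> \<longleftrightarrow> (\<forall>u\<in>words_of A. \<forall>v\<in>words_of B. \<gamma> (cls u) = cls v \<longrightarrow> interchangeable u v)"
    proof (rule ball_cong[OF refl])
      fix u assume u: "u \<in> words_of A"
      then have "\<gamma> (cls u) \<in> F"
        using bij unfolding E by (auto dest: bij_betwE)
      then obtain v where v: "v \<in> words_of B" "\<gamma> (cls u) = cls v"
        unfolding F by blast
      have "?same (cls u) (\<gamma> (cls u)) \<Longrightarrow> interchangeable u v'"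
        if "v' \<in> words_of B" "\<gamma> (cls u) = cls v'" for v'
        using iff[OF u that(1)] that(2) by simp
      moreover have "interchangeable u v \<Longrightarrow> ?same (cls u) (\<gamma> (cls u))"
        using iff[OF u v(1)] v(2) by simp
      ultimately show "?same (cls u) (\<gamma> (cls u)) \<longleftrightarrow>
          (\<forall>v\<in>words_of B. \<gamma> (cls u) = cls v \<longrightarrow> interchangeable u v)"
        using v by blast
    qed
    finally show ?thesis .
  qed
  have "kgraph_periodic k m \<theta> \<pi> \<longleftrightarrow> (\<forall>\<tau>\<in>tails k m \<theta>. tail_periodic k m \<theta> \<pi> \<tau>)"
  proof
    assume ev: "kgraph_periodic k m \<theta> \<pi>"
    have "\<exists>M\<in>vecs k. \<forall>n\<in>vecs k. M \<le> n \<longrightarrow> symbol x (A + n) = symbol x (B + n)" if x: "x \<in> TW" for x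
    proof -
      have "tail_eventually_periodic k m \<theta> \<pi> (tcls x)"
        using ev x tails_iff unfolding kgraph_periodic_def by blast
      from tail_eventually_periodic_symbols[OF x A B \<pi> this] show ?thesis
        by metis
    qed
    then show "\<forall>\<tau>\<in>tails k m \<theta>. tail_periodic k m \<theta> \<pi> \<tau>"
      unfolding periodic using eventually_periodic_imp_periodic[OF k A B] by blast
  next
    assume per: "\<forall>\<tau>\<in>tails k m \<theta>. tail_periodic k m \<theta> \<pi> \<tau>"
    show "kgraph_periodic k m \<theta> \<pi>"
      unfolding kgraph_periodic_def
    proof
      fix \<tau> assume "\<tau> \<in> tails k m \<theta>"
      with per have "tail_periodic k m \<theta> \<pi> \<tau>" by blast
      moreover
      \<comment> \<open>With \<open>T = - A\<close> also \<open>T + \<pi> = - B\<close> is nonpositive.\<close>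
      let ?T = "\<lambda>i. - int (A i)"
      have "?T \<in> vecs k" "?T \<le> 0" "?T + \<pi> \<le> 0"
        using A by (auto simp: vecs_def le_fun_def \<pi>)
      moreover have "n \<le> 0 \<and> n + \<pi> \<le> 0" if "n \<le> ?T" for n
      proof -
        have "n i \<le> - int (A i)" for i
          using le_funD[OF that, of i] .
        then have "n i \<le> 0 \<and> n i + \<pi> i \<le> 0" for i
          unfolding \<pi> by (smt (verit) of_nat_0_le_iff)
        then show ?thesis
          by (simp add: le_fun_def)
      qed
      ultimately show "tail_eventually_periodic k m \<theta> \<pi> \<tau>"
        unfolding tail_eventually_periodic_def tail_periodic_def by blast
    qed
  qed
  moreover have "(\<forall>\<tau>\<in>tails k m \<theta>. tail_periodic k m \<theta> \<pi> \<tau>) \<longleftrightarrow> (\<exists>\<gamma>. ?exchange \<gamma> \<and> ?same_tails \<gamma>)"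
  proof
    assume "\<forall>\<tau>\<in>tails k m \<theta>. tail_periodic k m \<theta> \<pi> \<tau>"
    then have per: "symbol x (A + n) = symbol x (B + n)" if "x \<in> TW" "n \<in> vecs k" for x n
      using that unfolding periodic by blast
    from periodic_imp_bijection[OF k A B per, folded E F] obtain \<gamma> where
      "bij_betw \<gamma> E F" "\<And>e f. e \<in> E \<Longrightarrow> f \<in> F \<Longrightarrow> e \<otimes>\<^bsub>S\<^esub> f = \<gamma> e \<otimes>\<^bsub>S\<^esub> inv_into E \<gamma> f"
      "\<And>u v. u \<in> words_of A \<Longrightarrow> v \<in> words_of B \<Longrightarrow> \<gamma> (cls u) = cls v \<Longrightarrow> interchangeable u v"
      by blast
    then show "\<exists>\<gamma>. ?exchange \<gamma> \<and> ?same_tails \<gamma>"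
      using same_tails by blast
  next
    assume "\<exists>\<gamma>. ?exchange \<gamma> \<and> ?same_tails \<gamma>"
    then obtain \<gamma> where \<gamma>: "bij_betw \<gamma> E F" "?same_tails \<gamma>"
      by blast
    have "\<exists>v\<in>words_of B. interchangeable u v" if u: "u \<in> words_of A" for u
    proof -
      have "\<gamma> (cls u) \<in> F"
        using \<gamma>(1) u unfolding E by (auto dest: bij_betwE)
      then obtain v where "v \<in> words_of B" "\<gamma> (cls u) = cls v"
        unfolding F by blast
      then show ?thesis
        using same_tails \<gamma> u by blast
    qed
    then show "\<forall>\<tau>\<in>tails k m \<theta>. tail_periodic k m \<theta> \<pi> \<tau>"
      unfolding periodic using interchangeable_imp_periodic[OF A] by blast
  qed
  moreover have "?same_tails \<gamma>" if "p + q = k" and \<gamma>: "?exchange \<gamma>" for \<gamma>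
  proof -
    have "A i + B i > 0" if "i \<in> {1..k}" for i
      using that \<open>p + q = k\<close> assms(5)[of i] assms(6)[of i] by (auto simp: A_def B_def)
    then show ?thesis
      unfolding same_tails[OF \<gamma>[THEN conjunct1]]
      using exchange_imp_interchangeable[OF A B, folded E F] \<gamma> by blast
  qed
  ultimately show ?thesis
    by blast
qed

end
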